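(* Let $f : \mathbb{R} \to \mathbb{R}$ be a locally absolutely continuous function. Then $f$ is (globally) absolutely continuous on $\mathbb{R}$ if and only if its almost-everywhere derivative $f'$ lies in $L^1_G(\mathbb{R})$. That is, for a function $f:\mathbb{R}\to\mathbb{R}$, $$f \in AC_{loc}(\mathbb{R}) \text{ and } f' \in L^1_G(\mathbb{R}) \iff f \in AC(\mathbb{R}).$$
   Context: $\mu$ denotes Lebesgue measure on $\mathbb{R}$. For an interval $I \subseteq \mathbb{R}$, a function $f : I \to \mathbb{R}$ is absolutely continuous on $I$ if for every $\varepsilon > 0$ there exists $\delta > 0$ such that for any finite collection of pairwise disjoint subintervals $\{(x_k,y_k)\}_{k=1}^n$ of $I$ with $\sum_{k=1}^n (y_k - x_k) < \delta$ one has $\sum_{k=1}^n |f(y_k) - f(x_k)| < \varepsilon$. $AC(I)$ is the space of functions $f: I \to \mathbb{R}$ that are absolutely continuous on $I$. $AC_{loc}(I)$ is the space of (measurable) functions $f : I \to \mathbb{R}$ that are absolutely continuous on every compact subinterval of $I$ (such functions are called locally absolutely continuous). $L^1_G(\mathbb{R})$ is the space of measurable functions $g : \mathbb{R} \to \mathbb{R}$ such that $\int_K |g| \, d\mu < \infty$ for every Lebesgue measurable set $K \subseteq \mathbb{R}$ with $\mu(K) < \infty$. A locally absolutely continuous function on $\mathbb{R}$ is differentiable almost everywhere, and $f'$ denotes its derivative, defined almost everywhere (the values on the exceptional null set are irrelevant to membership in $L^1_G(\mathbb{R})$). *)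

theory Defs
  imports "HOL-Analysis.Analysis"
begin

text \<open>
  Functions are total on \<^typ>\<open>real\<close>; for a proper subinterval I, only the values on I matter
  in the two function spaces below. Each subinterval is required to lie in I together with
  its endpoints, since f is evaluated there; disjointness is that of the open intervals, so
  neighbouring ones may share an endpoint.
\<close>

definition AC :: "real set \<Rightarrow> (real \<Rightarrow> real) set" where
  "AC I = {f. \<forall>\<epsilon>>0. \<exists>\<delta>>0. \<forall>(n::nat) (x::nat \<Rightarrow> real) (y::nat \<Rightarrow> real).
      (\<forall>k\<in>{1..n}. x k < y k \<and> {x k..y k} \<subseteq> I) \<longrightarrow>
      disjoint_family_on (\<lambda>k. {x k<..<y k}) {1..n} \<longrightarrow>
      (\<Sum>k=1..n. y k - x k) < \<delta> \<longrightarrow>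
      (\<Sum>k=1..n. \<bar>f (y k) - f (x k)\<bar>) < \<epsilon>}"

definition AC_loc :: "real set \<Rightarrow> (real \<Rightarrow> real) set" where
  "AC_loc I = {f. f \<in> borel_measurable (lebesgue_on I) \<and>
      (\<forall>a b. a \<le> b \<longrightarrow> {a..b} \<subseteq> I \<longrightarrow> f \<in> AC {a..b})}"

definition L1_G :: "(real \<Rightarrow> real) set" where
  "L1_G = {g. g \<in> borel_measurable lebesgue \<and>
      (\<forall>K\<in>sets lebesgue. emeasure lebesgue K < \<infinity> \<longrightarrow>
         (\<integral>\<^sup>+x\<in>K. ennreal \<bar>g x\<bar> \<partial>lebesgue) < \<infinity>)}"

text \<open>
  The almost-everywhere derivative of f is rendered by \<^term>\<open>deriv f\<close>, which takes an
  arbitrary value where f is not differentiable. For locally absolutely continuous f these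
  points form a null set, so, the Lebesgue measure being complete, the choice of
  values affects neither measurability nor membership in \<^const>\<open>L1_G\<close>.
\<close>

end

theory Submission
  imports Defs
begin

text \<open>
  Everything rests on the fundamental theorem of calculus for a locally absolutely continuous
  \<open>f\<close>: it is differentiable almost everywhere, and its increments are the integrals of its
  derivative. Differentiability comes from the Vitali covering theorem. If the slopes of \<open>f\<close> over short
  intervals around the points of a set of positive measure oscillated between \<open>p\<close> and \<open>q\<close> with
  \<open>p < q\<close>, or were unbounded, then suitable finite families of disjoint intervals that almost exhaust the
  set would have total increments incompatible with absolute continuity
  (\<open>slopes_above_below_negligible\<close>, \<open>infinite_slopes_negligible\<close>). The integral formula
  (\<open>AC_has_integral_derivative\<close>) is proved for the gauge integral, where absolute continuity
  is what disposes of the intervals whose tags lie in the exceptional null set.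

  Given this, let the derivative belong to \<open>L1_G\<close>. Its integral over a set is then uniformly small when the
  measure of the set is small: otherwise sets with summable measures and integrals
  bounded below would have a union of finite measure contradicting the Borel-Cantelli lemma
  (\<open>small_measure_small_integral\<close>). Since the increments of \<open>f\<close> are integrals of the derivative, \<open>f\<close>
  is absolutely continuous.

  Conversely, let \<open>f\<close> be absolutely continuous on the line, and let \<open>\<delta>\<close> belong to \<open>\<epsilon> = 1\<close>. The integral of
  \<open>\<bar>deriv f\<bar>\<close> over an interval is the supremum of the sums of \<open>\<bar>f v - f u\<bar>\<close> over its divisions, so
  the integral over a finite union of intervals of total length below \<open>\<delta>\<close> is at most \<open>1\<close>
  (\<open>nn_integral_deriv_elementary\<close>). The bound passes to open sets, and a set of finite
  measure lies in an open set of measure below \<open>\<delta>\<close> together with a bounded interval.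
\<close>

section \<open>Absolute continuity on divisions\<close>

text \<open>
  The \<open>\<epsilon>\<close>-\<open>\<delta>\<close> clause of absolute continuity with both constants visible, because most
  estimates below use one fixed pair \<open>\<epsilon>\<close>, \<open>\<delta>\<close>.
\<close>

definition ac_bound :: "(real \<Rightarrow> real) \<Rightarrow> real set \<Rightarrow> real \<Rightarrow> real \<Rightarrow> bool" where
  "ac_bound f I \<epsilon> \<delta> \<longleftrightarrow> (\<forall>(n::nat) x y.
      (\<forall>k\<in>{1..n}. x k < y k \<and> {x k..y k} \<subseteq> I) \<longrightarrow>
      disjoint_family_on (\<lambda>k. {x k<..<y k}) {1..n} \<longrightarrow>
      (\<Sum>k=1..n. y k - x k) < \<delta> \<longrightarrow> (\<Sum>k=1..n. \<bar>f (y k) - f (x k)\<bar>) < \<epsilon>)"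

lemma AC_iff_ac_bound: "f \<in> AC I \<longleftrightarrow> (\<forall>\<epsilon>>0. \<exists>\<delta>>0. ac_bound f I \<epsilon> \<delta>)"
  by (simp add: AC_def ac_bound_def)

text \<open>
  Enumerating an arbitrary finite index set frees the applications from bookkeeping with
  \<open>{1..n}\<close>.
\<close>

lemma ac_bound_finite:
  assumes ac: "ac_bound f I \<epsilon> \<delta>" and fin: "finite A"
    and lr: "\<And>i. i \<in> A \<Longrightarrow> l i < r i \<and> {l i..r i} \<subseteq> I"
    and disj: "disjoint_family_on (\<lambda>i. {l i<..<r i}) A"
    and less: "(\<Sum>i\<in>A. r i - l i) < \<delta>"
  shows "(\<Sum>i\<in>A. \<bar>f (r i) - f (l i)\<bar>) < \<epsilon>"
proof -
  obtain h where h: "bij_betw h {1..card A} A"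
    using ex_bij_betw_nat_finite_1[OF fin] by blast
  have hA: "h k \<in> A" if "k \<in> {1..card A}" for k
    using bij_betwE[OF h] that by blast
  have d: "disjoint_family_on (\<lambda>k. {l (h k)<..<r (h k)}) {1..card A}"
    unfolding disjoint_family_on_def
  proof (intro ballI impI)
    fix m n assume mn: "m \<in> {1..card A}" "n \<in> {1..card A}" "m \<noteq> n"
    then have "h m \<noteq> h n" using inj_on_contraD[OF bij_betw_imp_inj_on[OF h]] by blast
    then show "{l (h m)<..<r (h m)} \<inter> {l (h n)<..<r (h n)} = {}"
      using disjoint_family_onD[OF disj hA[OF mn(1)] hA[OF mn(2)]] by simp
  qed
  have *: "(\<Sum>k=1..card A. g (h k)) = (\<Sum>i\<in>A. g i)" for g :: "_ \<Rightarrow> real"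
    by (rule sum.reindex_bij_betw[OF h])
  show ?thesis
    using ac[unfolded ac_bound_def, rule_format, of "card A" "\<lambda>k. l (h k)" "\<lambda>k. r (h k)"] lr[OF hA] d less
    unfolding *[of "\<lambda>i. r i - l i"] *[of "\<lambda>i. \<bar>f (r i) - f (l i)\<bar>"]
    by blast
qed

lemma ac_bound_mono: "ac_bound f I \<epsilon> \<delta> \<Longrightarrow> J \<subseteq> I \<Longrightarrow> ac_bound f J \<epsilon> \<delta>"
  unfolding ac_bound_def by (meson subset_trans)

lemma AC_mono: "f \<in> AC I \<Longrightarrow> J \<subseteq> I \<Longrightarrow> f \<in> AC J"
  unfolding AC_iff_ac_bound using ac_bound_mono by blast

lemma AC_continuous_on:
  assumes "f \<in> AC {a..b}"
  shows "continuous_on {a..b} f"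
proof (rule continuous_onI)
  fix x e :: real assume x: "x \<in> {a..b}" and e: "0 < e"
  then obtain \<delta> where \<delta>: "\<delta> > 0" "ac_bound f {a..b} e \<delta>"
    using assms AC_iff_ac_bound by blast
  have "dist (f y) (f x) \<le> e" if y: "y \<in> {a..b}" "dist y x < \<delta>" for y
  proof (cases "x = y")
    case False
    then have "(\<Sum>i\<in>{0::nat}. \<bar>f (max x y) - f (min x y)\<bar>) < e"
      using x y by (intro ac_bound_finite[OF \<delta>(2)]) (auto simp: disjoint_family_on_def dist_real_def min_def max_def)
    then show ?thesis by (auto simp: dist_real_def min_def max_def split: if_splits)
  qed (use e in auto)
  then show "\<exists>d>0. \<forall>y\<in>{a..b}. dist y x < d \<longrightarrow> dist (f y) (f x) \<le> e"
    using \<delta>(1) by blast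
qed

definition incr :: "(real \<Rightarrow> real) \<Rightarrow> real set \<Rightarrow> real" where
  "incr f k = f (Sup k) - f (Inf k)"

lemma incr_Icc [simp]: "u \<le> v \<Longrightarrow> incr f {u..v} = f v - f u"
  by (simp add: incr_def)

lemma sum_incr_division:
  assumes "q division_of {a..b}" "a \<le> b"
  shows "(\<Sum>k\<in>q. incr f k) = f b - f a"
proof -
  note q = division_ofD[OF assms(1)]
  have Inf_in: "Inf k \<in> k" if k: "k \<in> q" for k
  proof -
    obtain u v where "k = cbox u v" "k \<noteq> {}" using q(3,4)[OF k] by blast
    then show ?thesis by simp
  qed
  have "(\<lambda>k. (Inf k, k)) ` q tagged_division_of {a..b}"
  proof (rule tagged_division_ofI)
    show "finite ((\<lambda>k. (Inf k, k)) ` q)" using q(1) by simp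
    show "\<Union>{K. \<exists>x. (x, K) \<in> (\<lambda>k. (Inf k, k)) ` q} = {a..b}" unfolding q(6)[symmetric] by blast
  next
    fix x K assume xK: "(x, K) \<in> (\<lambda>k. (Inf k, k)) ` q"
    then have "K \<in> q" "x = Inf K" by auto
    then show "x \<in> K" "K \<subseteq> {a..b}" "\<exists>a b. K = cbox a b"
      using Inf_in q(2,4) by blast+
    fix y L assume "(y, L) \<in> (\<lambda>k. (Inf k, k)) ` q" "(x, K) \<noteq> (y, L)"
    then have "L \<in> q" "K \<noteq> L" using xK by auto
    then show "interior K \<inter> interior L = {}" using q(5) \<open>K \<in> q\<close> by blast
  qed
  then have "(\<Sum>(x,k)\<in>(\<lambda>k. (Inf k, k)) ` q. f (Sup k) - f (Inf k)) = f b - f a"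
    by (rule additive_tagged_division_1[OF \<open>a \<le> b\<close>])
  then show ?thesis
    by (subst (asm) sum.reindex) (auto simp: inj_on_def incr_def)
qed

text \<open>
  The intervals to which absolute continuity is applied arise as subintervals of the members
  of a division, found separately in each member. The double sum is a sum over the disjoint
  sum of the \<open>C k\<close>; this index set, rather than the union of the \<open>C k\<close>, makes repeated
  members harmless. One-point intervals are dropped first: they contribute nothing to either
  sum, and \<^const>\<open>ac_bound\<close> speaks of nondegenerate intervals only.
\<close>

lemma ac_bound_nested:
  assumes ac: "ac_bound f I \<epsilon> \<delta>"
    and p: "p division_of \<Union>p" "\<Union>p \<subseteq> I"
    and C: "\<And>k. k \<in> p \<Longrightarrow> C k division_of \<Union>(C k) \<and> \<Union>(C k) \<subseteq> k"
    and less: "(\<Sum>k\<in>p. \<Sum>c\<in>C k. measure lebesgue c) < \<delta>"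
  shows "(\<Sum>k\<in>p. \<Sum>c\<in>C k. \<bar>incr f c\<bar>) < \<epsilon>"
proof -
  define D where "D = (\<lambda>k. {c \<in> C k. Inf c < Sup c})"
  have Cform: "\<exists>u v. c = {u..v} \<and> u \<le> v" if "k \<in> p" "c \<in> C k" for k c
    using division_ofD(3,4)[of "C k" _ c] C[OF that(1)] that(2) by (metis atLeastatMost_empty_iff2 box_real(2))
  have finp: "finite p" and finC: "\<And>k. k \<in> p \<Longrightarrow> finite (C k)"
    using p C by auto
  then have finD: "\<And>k. k \<in> p \<Longrightarrow> finite (D k)" by (auto simp: D_def)
  have Dform: "{Inf c..Sup c} = c" "{Inf c<..<Sup c} = interior c" "measure lebesgue c = Sup c - Inf c"
    "Inf c < Sup c" "c \<subseteq> k"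
    if "k \<in> p" "c \<in> D k" for k c
    using Cform[of k c] that C[of k] by (auto simp: D_def)
  have red: "(\<Sum>c\<in>C k. g c) = (\<Sum>c\<in>D k. g c)"
    if k: "k \<in> p" and g: "\<And>c. c \<in> C k \<Longrightarrow> \<not> Inf c < Sup c \<Longrightarrow> g c = 0" for g :: "real set \<Rightarrow> real" and k
    using g by (intro sum.mono_neutral_right finC[OF k]) (auto simp: D_def)
  have ii: "(\<Sum>i\<in>Sigma p D. g (snd i)) = (\<Sum>k\<in>p. \<Sum>c\<in>C k. g c)"
    if g: "\<And>k c. k \<in> p \<Longrightarrow> c \<in> C k \<Longrightarrow> \<not> Inf c < Sup c \<Longrightarrow> g c = 0" for g :: "real set \<Rightarrow> real"
  proof -
    have "(\<Sum>k\<in>p. \<Sum>c\<in>C k. g c) = (\<Sum>k\<in>p. \<Sum>c\<in>D k. g c)"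
      by (intro sum.cong refl red g) auto
    also have "\<dots> = (\<Sum>(k,c)\<in>Sigma p D. g c)"
      using finp finD by (intro sum.Sigma) auto
    finally show ?thesis by (simp add: split_def)
  qed
  have disj: "disjoint_family_on (\<lambda>i. {Inf (snd i)<..<Sup (snd i)}) (Sigma p D)"
    unfolding disjoint_family_on_def
  proof (intro ballI impI)
    fix i j assume ij: "i \<in> Sigma p D" "j \<in> Sigma p D" "i \<noteq> j"
    obtain k c k' c' where [simp]: "i = (k,c)" "j = (k',c')" by (metis surj_pair)
    have m: "k \<in> p" "c \<in> D k" "k' \<in> p" "c' \<in> D k'" "c \<in> C k" "c' \<in> C k'" using ij by (auto simp: D_def)
    have "interior c \<inter> interior c' = {}"
    proof (cases "k = k'")
      case True
      then show ?thesis using ij m C[of k] division_ofD(5)[of "C k" _ c c'] by auto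
    next
      case False
      then have "interior k \<inter> interior k' = {}" using p m division_ofD(5) by blast
      then show ?thesis
        using interior_mono[OF Dform(5)[OF m(1,2)]] interior_mono[OF Dform(5)[OF m(3,4)]] by blast
    qed
    then show "{Inf (snd i)<..<Sup (snd i)} \<inter> {Inf (snd j)<..<Sup (snd j)} = {}"
      using Dform(2) m by simp
  qed
  have deg: "Inf c = Sup c \<and> measure lebesgue c = 0" if "k \<in> p" "c \<in> C k" "\<not> Inf c < Sup c" for k c
    using Cform[OF that(1,2)] that(3) by auto
  have "(\<Sum>i\<in>Sigma p D. \<bar>f (Sup (snd i)) - f (Inf (snd i))\<bar>) < \<epsilon>"
  proof (rule ac_bound_finite[OF ac _ _ disj])
    show "finite (Sigma p D)" using finp finD by auto
    show "Inf (snd i) < Sup (snd i) \<and> {Inf (snd i)..Sup (snd i)} \<subseteq> I" if "i \<in> Sigma p D" for i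
    proof -
      have "fst i \<in> p" "snd i \<in> D (fst i)" using that by auto
      then show ?thesis using Dform[of "fst i" "snd i"] p(2) Union_upper[of "fst i" p] by simp
    qed
    have "(\<Sum>i\<in>Sigma p D. Sup (snd i) - Inf (snd i)) = (\<Sum>i\<in>Sigma p D. measure lebesgue (snd i))"
      using Dform(3) by (intro sum.cong) auto
    also have "\<dots> < \<delta>"
      using less deg by (subst ii) auto
    finally show "(\<Sum>i\<in>Sigma p D. Sup (snd i) - Inf (snd i)) < \<delta>" .
  qed
  moreover have "(\<Sum>i\<in>Sigma p D. \<bar>f (Sup (snd i)) - f (Inf (snd i))\<bar>) = (\<Sum>k\<in>p. \<Sum>c\<in>C k. \<bar>incr f c\<bar>)"
    unfolding incr_def
  proof (rule ii[where g="\<lambda>c. \<bar>f (Sup c) - f (Inf c)\<bar>"])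
    show "\<bar>f (Sup c) - f (Inf c)\<bar> = 0" if "k \<in> p" "c \<in> C k" "\<not> Inf c < Sup c" for k c
      using deg[OF that] by simp
  qed
  ultimately show ?thesis by simp
qed

lemma ac_bound_division:
  assumes "ac_bound f I \<epsilon> \<delta>" and p: "p division_of \<Union>p" "\<Union>p \<subseteq> I" and "(\<Sum>k\<in>p. measure lebesgue k) < \<delta>"
  shows "(\<Sum>k\<in>p. \<bar>incr f k\<bar>) < \<epsilon>"
proof -
  have "{k} division_of \<Union>{k} \<and> \<Union>{k} \<subseteq> k" if "k \<in> p" for k
    using division_ofD(3,4)[OF p(1) that] by (auto simp: division_of_def)
  then show ?thesis
    using ac_bound_nested[OF assms(1) p, of "\<lambda>k. {k}"] assms(4) by simp
qed

text \<open>
  If the intervals of \<open>q\<close> fill those of \<open>p\<close> up to length \<open>\<delta>\<close>, then completing \<open>q\<close> to a division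
  of each member of \<open>p\<close> adds intervals of total length below \<open>\<delta>\<close>, and the difference of the
  two sums of increments is the sum over these added intervals. In the proof of
  differentiability this replaces the monotonicity that Lebesgue's theorem on monotone
  functions relies on.
\<close>

lemma ac_bound_refinement:
  assumes ac: "ac_bound f I \<epsilon> \<delta>"
    and p: "p division_of \<Union>p" "\<Union>p \<subseteq> I"
    and q: "q division_of \<Union>q" "\<And>c. c \<in> q \<Longrightarrow> interior c \<noteq> {} \<and> (\<exists>k\<in>p. c \<subseteq> k)"
    and less: "(\<Sum>k\<in>p. measure lebesgue k) - (\<Sum>c\<in>q. measure lebesgue c) < \<delta>"
  shows "\<bar>(\<Sum>k\<in>p. incr f k) - (\<Sum>c\<in>q. incr f c)\<bar> < \<epsilon>"
proof -
  define Q where "Q = (\<lambda>k. {c \<in> q. c \<subseteq> k})"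
  have finp: "finite p" "finite q" using p q by auto
  have pform: "\<exists>a b. k = {a..b} \<and> a \<le> b" if k: "k \<in> p" for k
  proof -
    obtain u v where "k = cbox u v" "k \<noteq> {}" using division_ofD(3,4)[OF p(1) k] by blast
    then show ?thesis by auto
  qed
  have Qsub: "Q k \<subseteq> q" for k by (auto simp: Q_def)
  have Qdiv: "Q k division_of \<Union>(Q k)" for k
    using division_of_subset[OF q(1) Qsub] .
  have "\<exists>R. Q k \<subseteq> R \<and> R division_of k" if "k \<in> p" for k
  proof -
    have "\<Union>(Q k) \<subseteq> k" by (auto simp: Q_def)
    with pform[OF that] partial_division_extend_interval[OF Qdiv, of k] show ?thesis
      by (metis box_real(2))
  qed
  then obtain R where R: "\<And>k. k \<in> p \<Longrightarrow> Q k \<subseteq> R k \<and> R k division_of k" by metis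
  define C where "C = (\<lambda>k. R k - Q k)"
  have Qsum: "(\<Sum>k\<in>p. \<Sum>c\<in>Q k. g c) = (\<Sum>c\<in>q. g c)" for g :: "real set \<Rightarrow> real"
  proof -
    have "(\<Union>k\<in>p. Q k) = q" using q(2) by (auto simp: Q_def)
    moreover have "Q k \<inter> Q k' = {}" if "k \<in> p" "k' \<in> p" "k \<noteq> k'" for k k'
    proof -
      have "interior k \<inter> interior k' = {}" using division_ofD(5)[OF p(1)] that by blast
      moreover have "interior c \<subseteq> interior k \<inter> interior k'" "interior c \<noteq> {}"
        if "c \<in> Q k" "c \<in> Q k'" for c
        using that q(2) interior_mono[of c] by (auto simp: Q_def)
      ultimately show ?thesis by (metis disjoint_iff subset_empty)
    qed
    ultimately show ?thesis
      using sum.UNION_disjoint[of p Q g] finp by (auto simp: Q_def)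
  qed
  \<comment> \<open>Used with increments and with lengths: both are additive over divisions of an interval.\<close>
  have split: "(\<Sum>k\<in>p. g k) - (\<Sum>c\<in>q. g c) = (\<Sum>k\<in>p. \<Sum>c\<in>C k. g c)"
    if g: "\<And>k. k \<in> p \<Longrightarrow> (\<Sum>c\<in>R k. g c) = g k" for g :: "real set \<Rightarrow> real"
  proof -
    have "(\<Sum>c\<in>C k. g c) = g k - (\<Sum>c\<in>Q k. g c)" if "k \<in> p" for k
      unfolding C_def g[OF that, symmetric] using R[OF that] by (intro sum_diff) auto
    then show ?thesis by (simp add: sum_subtractf Qsum)
  qed
  have "(\<Sum>k\<in>p. \<Sum>c\<in>C k. \<bar>incr f c\<bar>) < \<epsilon>"
  proof (rule ac_bound_nested[OF ac p])
    show "C k division_of \<Union>(C k) \<and> \<Union>(C k) \<subseteq> k" if "k \<in> p" for k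
      using R[OF that] division_of_subset[of "R k" "C k"] by (auto simp: C_def)
    show "(\<Sum>k\<in>p. \<Sum>c\<in>C k. measure lebesgue c) < \<delta>"
    proof (subst split[symmetric])
      fix k assume k: "k \<in> p"
      show "(\<Sum>c\<in>R k. measure lebesgue c) = measure lebesgue k"
        using content_division[of "R k" k] R[OF k] by simp
    qed (use less in simp)
  qed
  moreover have "\<bar>\<Sum>k\<in>p. \<Sum>c\<in>C k. incr f c\<bar> \<le> (\<Sum>k\<in>p. \<Sum>c\<in>C k. \<bar>incr f c\<bar>)"
    by (rule order_trans[OF sum_abs sum_mono[OF sum_abs]])
  moreover have "(\<Sum>k\<in>p. incr f k) - (\<Sum>c\<in>q. incr f c) = (\<Sum>k\<in>p. \<Sum>c\<in>C k. incr f c)"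
  proof (rule split)
    fix k assume "k \<in> p"
    with pform obtain a b where "k = {a..b}" "a \<le> b" by blast
    then show "(\<Sum>c\<in>R k. incr f c) = incr f k"
      using sum_incr_division[of "R k" a b] R[OF \<open>k \<in> p\<close>] by simp
  qed
  ultimately show ?thesis by linarith
qed

section \<open>Vitali coverings by intervals\<close>

text \<open>
  The points at which the intervals \<open>{u..v}\<close> with \<open>P u v\<close> form a Vitali cover. The point is
  required to lie strictly between \<open>u\<close> and \<open>v\<close>, so that the set is a countable intersection of
  open sets and is therefore Borel; this avoids outer measures.
\<close>

definition vitali_points :: "(real \<Rightarrow> real \<Rightarrow> bool) \<Rightarrow> real set" where
  "vitali_points P = {x. \<forall>d>0. \<exists>u v. P u v \<and> u < x \<and> x < v \<and> v - u < d}"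

lemma vitali_points_measurable: "vitali_points P \<in> sets borel"
proof -
  define C where "C n = {(u,v). P u v \<and> v - u < inverse (real (Suc n))}" for n
  have C: "x \<in> (\<Union>(u,v)\<in>C n. {u<..<v}) \<longleftrightarrow>
      (\<exists>u v. P u v \<and> u < x \<and> x < v \<and> v - u < inverse (real (Suc n)))" for x n
    unfolding C_def by auto
  have "vitali_points P = (\<Inter>n. \<Union>(u,v)\<in>C n. {u<..<v})"
  proof (intro set_eqI iffI)
    fix x assume "x \<in> (\<Inter>n. \<Union>(u,v)\<in>C n. {u<..<v})"
    then have x: "\<exists>u v. P u v \<and> u < x \<and> x < v \<and> v - u < inverse (real (Suc n))" for n
      unfolding C[symmetric] by blast
    have "\<exists>u v. P u v \<and> u < x \<and> x < v \<and> v - u < d" if d: "d > 0" for d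
    proof -
      obtain n where n: "inverse (real (Suc n)) < d" using reals_Archimedean[OF d] by blast
      with x[of n] show ?thesis by (meson less_trans)
    qed
    then show "x \<in> vitali_points P" by (simp add: vitali_points_def)
  next
    fix x assume x: "x \<in> vitali_points P"
    have "\<exists>u v. P u v \<and> u < x \<and> x < v \<and> v - u < inverse (real (Suc n))" for n
      using x unfolding vitali_points_def by simp
    then show "x \<in> (\<Inter>n. \<Union>(u,v)\<in>C n. {u<..<v})"
      unfolding C[symmetric] by blast
  qed
  also have "\<dots> \<in> sets borel"
    by (intro sets.countable_INT'' borel_open open_UN) auto
  finally show ?thesis .
qed

lemma vitali_points_restrict:
  assumes "x \<in> vitali_points P" "open U" "x \<in> U"
  shows "x \<in> vitali_points (\<lambda>u v. P u v \<and> {u..v} \<subseteq> U)"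
proof -
  obtain e where e: "e > 0" "ball x e \<subseteq> U" using assms(2,3) open_contains_ball by blast
  have "\<exists>u v. (P u v \<and> {u..v} \<subseteq> U) \<and> u < x \<and> x < v \<and> v - u < d" if "d > 0" for d
  proof -
    obtain u v where uv: "P u v" "u < x" "x < v" "v - u < min d e"
      using assms(1) \<open>d > 0\<close> \<open>e > 0\<close> unfolding vitali_points_def mem_Collect_eq by (metis min_less_iff_conj)
    then have "{u..v} \<subseteq> ball x e" by (auto simp: dist_real_def)
    with uv e show ?thesis by (intro exI[of _ u] exI[of _ v]) auto
  qed
  then show ?thesis by (simp add: vitali_points_def)
qed

text \<open>
  The Vitali covering theorem yields countably many disjoint intervals that cover almost all
  of \<open>E\<close>; finitely many of them already cover all but measure \<open>\<eta>\<close>, by continuity of the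
  measure from above.
\<close>

lemma Vitali_finite_intervals:
  assumes E: "E \<in> lmeasurable" and P: "E \<subseteq> vitali_points P" and "\<eta> > 0"
  obtains D where "D division_of \<Union>D" "\<And>k. k \<in> D \<Longrightarrow> \<exists>u v. k = {u..v} \<and> u < v \<and> P u v"
    "measure lebesgue (E - \<Union>D) < \<eta>"
proof -
  define K where "K = {(u,v). u < v \<and> P u v}"
  define a where "a = (\<lambda>(u,v). (u + v) / (2::real))"
  define r where "r = (\<lambda>(u,v). (v - u) / (2::real))"
  have cb: "cball (a i) (r i) = {fst i..snd i}" for i
    by (auto simp: cball_eq_atLeastAtMost a_def r_def split_def field_simps)
  obtain C where C: "countable C" "C \<subseteq> K"
    "pairwise (\<lambda>i j. disjnt (cball (a i) (r i)) (cball (a j) (r j))) C"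
    "negligible (E - (\<Union>i\<in>C. cball (a i) (r i)))"
  proof (rule Vitali_covering_theorem_cballs[of K r E a])
    show "0 < r i" if "i \<in> K" for i using that by (auto simp: K_def r_def)
    fix x d :: real assume "x \<in> E" "0 < d"
    then obtain u v where uv: "P u v" "u < x" "x < v" "v - u < d"
      using P unfolding vitali_points_def by blast
    then show "\<exists>i. i \<in> K \<and> x \<in> cball (a i) (r i) \<and> r i < d"
      unfolding cb by (intro exI[of _ "(u,v)"]) (auto simp: K_def r_def)
  qed blast
  define J where "J = (\<lambda>i::real\<times>real. {fst i..snd i})"
  have Jle: "fst i < snd i \<and> P (fst i) (snd i)" if "i \<in> C" for i using C(2) that by (auto simp: K_def)
  have fin: "\<exists>F. finite F \<and> F \<subseteq> C \<and> measure lebesgue (E - (\<Union>i\<in>F. J i)) < \<eta>"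
  proof (cases "C = {}")
    case True
    then show ?thesis
      using C(4) \<open>\<eta> > 0\<close> by (intro exI[of _ "{}"]) (auto simp: negligible_imp_measure0)
  next
    case False
    define h where "h = from_nat_into C"
    have h: "range h = C" using False C(1) by (simp add: h_def range_from_nat_into)
    define G where "G n = E - (\<Union>i\<in>h ` {..<n}. J i)" for n
    have J_l: "J i \<in> lmeasurable" for i by (simp add: J_def)
    have G: "G n \<in> lmeasurable" for n
      unfolding G_def by (intro fmeasurable.Diff E fmeasurable.finite_UN) (auto simp: J_l)
    have "(\<lambda>n. measure lebesgue (G n)) \<longlonglongrightarrow> measure lebesgue (\<Inter>n. G n)"
    proof (rule Lim_measure_decseq)
      show "range G \<subseteq> sets lebesgue" using G by (auto simp: fmeasurableD)
      show "decseq G" unfolding G_def decseq_def by force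
      show "emeasure lebesgue (G i) \<noteq> \<infinity>" for i using fmeasurableD2[OF G] by simp
    qed
    moreover have "(\<Inter>n. G n) = E - (\<Union>i\<in>C. J i)"
      unfolding G_def h[symmetric] by (auto intro: lessI)
    then have "measure lebesgue (\<Inter>n. G n) = 0"
      using C(4) by (simp add: cb J_def negligible_imp_measure0)
    ultimately have "\<forall>\<^sub>F n in sequentially. measure lebesgue (G n) < \<eta>"
      using \<open>\<eta> > 0\<close> by (simp add: order_tendstoD)
    then obtain n where "measure lebesgue (G n) < \<eta>" by (auto simp: eventually_sequentially)
    then show ?thesis using h by (intro exI[of _ "h ` {..<n}"]) (auto simp: G_def)
  qed
  then obtain F where F: "finite F" "F \<subseteq> C" "measure lebesgue (E - (\<Union>i\<in>F. J i)) < \<eta>" by blast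
  show thesis
  proof
    show "measure lebesgue (E - \<Union>(J ` F)) < \<eta>" using F(3) by simp
    show "\<exists>u v. k = {u..v} \<and> u < v \<and> P u v" if "k \<in> J ` F" for k
      using that Jle F(2) unfolding J_def by blast
    show "J ` F division_of \<Union>(J ` F)"
    proof (rule division_ofI)
      show "finite (J ` F)" using F by simp
      fix k assume k: "k \<in> J ` F"
      then obtain i where i: "i \<in> F" "k = J i" by blast
      then have "fst i < snd i" using Jle F(2) by blast
      then show "k \<noteq> {}" using i by (simp add: J_def)
      show "k \<subseteq> \<Union>(J ` F)" using k by blast
      show "\<exists>a b. k = cbox a b" using i by (auto simp: J_def)
      fix l assume "l \<in> J ` F" "k \<noteq> l"
      then obtain j where j: "j \<in> F" "l = J j" "i \<noteq> j" using i by blast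
      then have "disjnt (J i) (J j)" using C(3) i F(2) unfolding cb pairwise_def J_def by blast
      then show "interior k \<inter> interior l = {}"
        unfolding i j disjnt_def by (meson disjoint_iff interior_subset subsetD)
    qed simp
  qed
qed

section \<open>Differentiability almost everywhere\<close>

lemma vitali_points_mono: "(\<And>u v. P u v \<Longrightarrow> Q u v) \<Longrightarrow> vitali_points P \<subseteq> vitali_points Q"
  unfolding vitali_points_def by blast

lemma division_measure_mono:
  assumes "D division_of \<Union>D" "\<Union>D \<subseteq> S" "S \<in> lmeasurable"
  shows "(\<Sum>k\<in>D. measure lebesgue k) \<le> measure lebesgue S"
  using content_division[OF assms(1)] measure_mono_fmeasurable[OF assms(2) _ assms(3)]
    lmeasurable_division[OF assms(1)] by (simp add: fmeasurableD)

text \<open>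
  Suppose that \<open>E\<close>, the set in question, has measure \<open>s > 0\<close>. A first Vitali covering, by
  intervals of slope below \<open>p\<close> inside an open set hardly larger than \<open>E\<close>, gives a finite family
  \<open>A\<close> of total length about \<open>s\<close> with total increment at most about \<open>p * s\<close>. A second one, by
  intervals of slope above \<open>q\<close> inside the members of \<open>A\<close>, gives a family \<open>B\<close> of total length
  again about \<open>s\<close> with total increment at least about \<open>q * s\<close>. By absolute continuity the two
  total increments nearly agree, so \<open>q * s\<close> is at most about \<open>p * s\<close>, which is impossible.
\<close>

lemma slopes_above_below_negligible:
  assumes f: "f \<in> AC {a..b}" and "p < q"
  shows "negligible (vitali_points (\<lambda>u v. f v - f u < p * (v - u))
      \<inter> vitali_points (\<lambda>u v. q * (v - u) < f v - f u) \<inter> {a<..<b})"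
    (is "negligible (vitali_points ?L \<inter> vitali_points ?H \<inter> _)")
proof -
  define E where "E = vitali_points ?L \<inter> vitali_points ?H \<inter> {a<..<b}"
  have "{a<..<b} \<in> lmeasurable" by simp
  moreover have "vitali_points ?L \<inter> vitali_points ?H \<in> sets lebesgue"
    using vitali_points_measurable by (intro sets.Int) auto
  ultimately have "{a<..<b} \<inter> (vitali_points ?L \<inter> vitali_points ?H) \<in> lmeasurable"
    by (rule fmeasurable_Int_fmeasurable)
  then have E: "E \<in> lmeasurable"
    unfolding E_def by (subst Int_commute)
  define s where "s = measure lebesgue E"
  have "s = 0"
  proof (rule ccontr)
    assume "s \<noteq> 0"
    then have "s > 0" by (simp add: s_def zero_less_measure_iff)
    \<comment> \<open>The errors add up to at most \<open>2 * \<epsilon>\<close>: one \<open>\<epsilon>\<close> from comparing \<open>A\<close> with \<open>B\<close>, another one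
       from replacing their total lengths by \<open>s\<close>. Hence \<open>4 * \<epsilon> = (q - p) * s \<le> 2 * \<epsilon>\<close> at the end.\<close>
    define \<epsilon> where "\<epsilon> = (q - p) * s / 4"
    have "\<epsilon> > 0" using \<open>s > 0\<close> \<open>p < q\<close> by (simp add: \<epsilon>_def)
    then obtain \<delta> where \<delta>: "\<delta> > 0" "ac_bound f {a..b} \<epsilon> \<delta>"
      using f AC_iff_ac_bound by blast
    define \<eta> where "\<eta> = min (\<delta> / 4) (\<epsilon> / (2 * (\<bar>p\<bar> + \<bar>q\<bar> + 1)))"
    have "\<eta> > 0" using \<open>\<epsilon> > 0\<close> \<open>\<delta> > 0\<close> by (simp add: \<eta>_def)
    obtain T where T: "open T" "E \<subseteq> T" "T - E \<in> lmeasurable" "emeasure lebesgue (T - E) < ennreal \<eta>"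
      using sets_lebesgue_outer_open[OF fmeasurableD[OF E] \<open>\<eta> > 0\<close>] .
    define W where "W = T \<inter> {a<..<b}"
    have W: "open W" "E \<subseteq> W" using T by (auto simp: W_def E_def)
    have Wl: "W \<in> lmeasurable" unfolding W_def using T(1) by (subst Int_commute) (intro fmeasurable_Int_fmeasurable; simp)
    have "measure lebesgue (T - E) < \<eta>"
      using T(3,4) \<open>\<eta> > 0\<close> by (simp add: emeasure_eq_measure2 ennreal_less_iff)
    moreover have "measure lebesgue (W - E) \<le> measure lebesgue (T - E)"
      using T(3) Wl E by (intro measure_mono_fmeasurable) (auto simp: W_def)
    moreover have "measure lebesgue (W - E) = measure lebesgue W - s"
      unfolding s_def using Wl E W(2) by (intro measurable_measure_Diff) auto
    ultimately have Ws: "measure lebesgue W < s + \<eta>" by linarith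
    have "E \<subseteq> vitali_points (\<lambda>u v. ?L u v \<and> {u..v} \<subseteq> W)"
      using vitali_points_restrict[OF _ W(1)] W(2) by (auto simp: E_def)
    from Vitali_finite_intervals[OF E this \<open>\<eta> > 0\<close>] obtain A where
      A: "A division_of \<Union>A" "\<And>k. k \<in> A \<Longrightarrow> \<exists>u v. k = {u..v} \<and> u < v \<and> ?L u v \<and> {u..v} \<subseteq> W"
        "measure lebesgue (E - \<Union>A) < \<eta>" by metis
    \<comment> \<open>The second covering needs room inside the members of \<open>A\<close>; their endpoints form a null set.\<close>
    define E' where "E' = E \<inter> (\<Union>k\<in>A. interior k)"
    have E': "E' \<in> lmeasurable"
      unfolding E'_def using E
      by (rule fmeasurable_Int_fmeasurable) (simp add: borel_open open_UN)
    have "E' \<subseteq> vitali_points (\<lambda>u v. ?H u v \<and> (\<exists>k\<in>A. {u..v} \<subseteq> k))"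
    proof
      fix x assume x: "x \<in> E'"
      then obtain k where k: "k \<in> A" "x \<in> interior k" by (auto simp: E'_def)
      have "x \<in> vitali_points (\<lambda>u v. ?H u v \<and> {u..v} \<subseteq> interior k)"
        using x k by (intro vitali_points_restrict) (auto simp: E'_def E_def)
      moreover have "vitali_points (\<lambda>u v. ?H u v \<and> {u..v} \<subseteq> interior k)
          \<subseteq> vitali_points (\<lambda>u v. ?H u v \<and> (\<exists>k\<in>A. {u..v} \<subseteq> k))"
        using k interior_subset[of k] by (intro vitali_points_mono) blast
      ultimately show "x \<in> vitali_points (\<lambda>u v. ?H u v \<and> (\<exists>k\<in>A. {u..v} \<subseteq> k))" by blast
    qed
    from Vitali_finite_intervals[OF E' this \<open>\<eta> > 0\<close>] obtain B where
      B: "B division_of \<Union>B" "\<And>c. c \<in> B \<Longrightarrow> \<exists>u v. c = {u..v} \<and> u < v \<and> ?H u v \<and> (\<exists>k\<in>A. {u..v} \<subseteq> k)"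
        "measure lebesgue (E' - \<Union>B) < \<eta>" by metis
    have Al: "\<Union>A \<in> lmeasurable" and Bl: "\<Union>B \<in> lmeasurable"
      using A(1) B(1) lmeasurable_division by blast+
    define \<alpha> where "\<alpha> = (\<Sum>k\<in>A. measure lebesgue k)"
    define \<beta> where "\<beta> = (\<Sum>k\<in>B. measure lebesgue k)"
    have AW: "\<Union>A \<subseteq> W" using A(2) by blast
    have BA: "\<Union>B \<subseteq> \<Union>A" using B(2) by blast
    have "\<alpha> \<le> measure lebesgue W" unfolding \<alpha>_def by (rule division_measure_mono[OF A(1) AW Wl])
    then have \<alpha>_le: "\<alpha> < s + \<eta>" using Ws by linarith
    have \<beta>\<alpha>: "\<beta> \<le> \<alpha>"
      using division_measure_mono[OF B(1) BA Al] content_division[OF A(1)] by (simp add: \<alpha>_def \<beta>_def)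
    have bd: "negligible (\<Union>k\<in>A. k - interior k)"
    proof (rule negligible_Union)
      show "finite ((\<lambda>k. k - interior k) ` A)" using A(1) by auto
      show "negligible X" if X: "X \<in> (\<lambda>k. k - interior k) ` A" for X
      proof -
        obtain k where k: "k \<in> A" "X = k - interior k" using X by blast
        with A(2)[OF k(1)] obtain u v where "k = {u..v}" by blast
        with k(2) have "X \<subseteq> {u,v}" by auto
        then show ?thesis by (rule negligible_subset[rotated]) simp
      qed
    qed
    have "E \<subseteq> (E - \<Union>A) \<union> (E' - \<Union>B) \<union> \<Union>B \<union> (\<Union>k\<in>A. k - interior k)"
      by (auto simp: E'_def)
    then have "s \<le> measure lebesgue ((E - \<Union>A) \<union> (E' - \<Union>B) \<union> \<Union>B \<union> (\<Union>k\<in>A. k - interior k))"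
      unfolding s_def using E E' Al Bl negligible_imp_measurable[OF bd]
      by (intro measure_mono_fmeasurable) (auto intro!: fmeasurable.Un fmeasurable.Diff dest: fmeasurableD)
    also have "\<dots> \<le> measure lebesgue (E - \<Union>A) + measure lebesgue (E' - \<Union>B) + measure lebesgue (\<Union>B)
        + measure lebesgue (\<Union>k\<in>A. k - interior k)"
    proof -
      have m: "E - \<Union>A \<in> sets lebesgue" "E' - \<Union>B \<in> sets lebesgue" "\<Union>B \<in> sets lebesgue"
        "(\<Union>k\<in>A. k - interior k) \<in> sets lebesgue"
        using E E' Al Bl negligible_imp_measurable[OF bd] by (auto dest: fmeasurableD)
      show ?thesis
        using measure_Un_le[OF sets.Un[OF sets.Un[OF m(1,2)] m(3)] m(4)]
          measure_Un_le[OF sets.Un[OF m(1,2)] m(3)] measure_Un_le[OF m(1,2)] by linarith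
    qed
    also have "\<dots> < 2 * \<eta> + \<beta>"
      using A(3) B(3) content_division[OF B(1)] negligible_imp_measure0[OF bd] by (simp add: \<beta>_def)
    finally have s_less: "s < 2 * \<eta> + \<beta>" .
    have "\<bar>(\<Sum>k\<in>A. incr f k) - (\<Sum>c\<in>B. incr f c)\<bar> < \<epsilon>"
    proof (rule ac_bound_refinement[OF \<delta>(2) A(1) _ B(1)])
      show "\<Union>A \<subseteq> {a..b}" using AW by (auto simp: W_def)
      show "interior c \<noteq> {} \<and> (\<exists>k\<in>A. c \<subseteq> k)" if "c \<in> B" for c
        using B(2)[OF that] by auto
      have "4 * \<eta> \<le> \<delta>" by (simp add: \<eta>_def)
      then show "(\<Sum>k\<in>A. measure lebesgue k) - (\<Sum>c\<in>B. measure lebesgue c) < \<delta>"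
        using \<alpha>_le s_less \<open>\<eta> > 0\<close> unfolding \<alpha>_def[symmetric] \<beta>_def[symmetric] by linarith
    qed
    moreover have "(\<Sum>k\<in>A. incr f k) \<le> p * \<alpha>"
      unfolding \<alpha>_def sum_distrib_left
    proof (rule sum_mono)
      show "incr f k \<le> p * measure lebesgue k" if "k \<in> A" for k
        using A(2)[OF that] by force
    qed
    moreover have "q * \<beta> \<le> (\<Sum>k\<in>B. incr f k)"
      unfolding \<beta>_def sum_distrib_left
    proof (rule sum_mono)
      show "q * measure lebesgue k \<le> incr f k" if "k \<in> B" for k
        using B(2)[OF that] by force
    qed
    ultimately have 1: "q * \<beta> \<le> p * \<alpha> + \<epsilon>" by linarith
    have "\<bar>p * (\<alpha> - s)\<bar> \<le> \<bar>p\<bar> * (2 * \<eta>)" "\<bar>q * (\<beta> - s)\<bar> \<le> \<bar>q\<bar> * (2 * \<eta>)"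
      unfolding abs_mult using \<alpha>_le s_less \<beta>\<alpha> \<open>\<eta> > 0\<close> by (intro mult_left_mono; linarith)+
    then have "q * s - \<bar>q\<bar> * (2 * \<eta>) \<le> p * s + \<bar>p\<bar> * (2 * \<eta>) + \<epsilon>"
      using 1 by (simp add: right_diff_distrib)
    then have "(q - p) * s \<le> (\<bar>p\<bar> + \<bar>q\<bar>) * (2 * \<eta>) + \<epsilon>" by (simp add: algebra_simps)
    also have "(\<bar>p\<bar> + \<bar>q\<bar>) * (2 * \<eta>) \<le> (\<bar>p\<bar> + \<bar>q\<bar> + 1) * (2 * \<eta>)"
      using \<open>\<eta> > 0\<close> by (intro mult_right_mono) auto
    also have "\<dots> \<le> \<epsilon>"
    proof -
      have "0 < 2 * (\<bar>p\<bar> + \<bar>q\<bar> + 1)" "\<eta> \<le> \<epsilon> / (2 * (\<bar>p\<bar> + \<bar>q\<bar> + 1))" by (auto simp: \<eta>_def)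
      then have "\<eta> * (2 * (\<bar>p\<bar> + \<bar>q\<bar> + 1)) \<le> \<epsilon>" by (simp only: pos_le_divide_eq)
      then show ?thesis by (simp add: algebra_simps)
    qed
    finally have "4 * \<epsilon> \<le> \<epsilon> + \<epsilon>" by (simp add: \<epsilon>_def)
    then show False using \<open>\<epsilon> > 0\<close> by simp
  qed
  then show ?thesis
    using E by (simp add: negligible_iff_measure E_def s_def)
qed

text \<open>
  Near such a point there are short intervals of slope at least \<open>q\<close> in absolute value. In a
  window shorter than the \<open>\<delta>\<close> belonging to \<open>\<epsilon> = 1\<close>, disjoint intervals of this kind have total
  variation below \<open>1\<close>, hence total length below \<open>1 / q\<close>, and \<open>q\<close> is arbitrary. Being negligible is
  a local property, so these windows suffice.
\<close>

lemma infinite_slopes_negligible: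
  assumes f: "f \<in> AC {a..b}"
  shows "negligible ((\<Inter>q\<in>\<rat>. vitali_points (\<lambda>u v. q * (v - u) < \<bar>f v - f u\<bar>)) \<inter> {a<..<b})"
proof -
  define E where "E = (\<Inter>q\<in>\<rat>. vitali_points (\<lambda>u v. q * (v - u) < \<bar>f v - f u\<bar>))"
  obtain \<delta> where \<delta>: "\<delta> > 0" "ac_bound f {a..b} 1 \<delta>"
    using f AC_iff_ac_bound zero_less_one by blast
  have E: "E \<in> sets lebesgue"
    unfolding E_def using vitali_points_measurable by (intro sets.countable_INT'') (auto simp: countable_rat)
  have small: "negligible (E \<inter> {c<..<d})" if cd: "{c<..<d} \<subseteq> {a<..<b}" "d - c < \<delta>" "c < d" for c d
  proof -
    define G where "G = E \<inter> {c<..<d}"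
    have G: "G \<in> lmeasurable"
      unfolding G_def using E by (subst Int_commute) (intro fmeasurable_Int_fmeasurable; simp)
    have G_le: "measure lebesgue G \<le> 1 / q + \<eta>" if q: "q \<in> \<rat>" "q > 0" "\<eta> > 0" for q \<eta>
    proof -
      have "G \<subseteq> vitali_points (\<lambda>u v. q * (v - u) < \<bar>f v - f u\<bar> \<and> {u..v} \<subseteq> {c<..<d})"
        using q(1) vitali_points_restrict[of _ _ "{c<..<d}"] by (auto simp: G_def E_def)
      from Vitali_finite_intervals[OF G this q(3)] obtain D where
        D: "D division_of \<Union>D" "\<And>k. k \<in> D \<Longrightarrow> \<exists>u v. k = {u..v} \<and> u < v \<and> q * (v - u) < \<bar>f v - f u\<bar> \<and> {u..v} \<subseteq> {c<..<d}"
          "measure lebesgue (G - \<Union>D) < \<eta>" by metis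
      have Dsub: "\<Union>D \<subseteq> {c<..<d}" using D(2) by blast
      have "(\<Sum>k\<in>D. measure lebesgue k) \<le> d - c"
        using division_measure_mono[OF D(1) Dsub] \<open>c < d\<close> by simp
      then have "(\<Sum>k\<in>D. \<bar>incr f k\<bar>) < 1"
        using cd Dsub greaterThanLessThan_subseteq_atLeastAtMost_iff[of a b a b]
        by (intro ac_bound_division[OF \<delta>(2) D(1)]) auto
      moreover have "q * (\<Sum>k\<in>D. measure lebesgue k) \<le> (\<Sum>k\<in>D. \<bar>incr f k\<bar>)"
        unfolding sum_distrib_left
      proof (rule sum_mono)
        show "q * measure lebesgue k \<le> \<bar>incr f k\<bar>" if "k \<in> D" for k using D(2)[OF that] by force
      qed
      ultimately have "q * (\<Sum>k\<in>D. measure lebesgue k) \<le> 1" by linarith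
      then have D_le: "measure lebesgue (\<Union>D) \<le> 1 / q"
        using q(2) content_division[OF D(1)] by (simp add: field_simps)
      have Dl: "\<Union>D \<in> lmeasurable" using D(1) lmeasurable_division by blast
      have "measure lebesgue G \<le> measure lebesgue ((G - \<Union>D) \<union> \<Union>D)"
        using G Dl by (intro measure_mono_fmeasurable) (auto dest: fmeasurableD)
      also have "\<dots> \<le> measure lebesgue (G - \<Union>D) + measure lebesgue (\<Union>D)"
        using G Dl by (intro measure_Un_le) (auto dest: fmeasurableD)
      finally show ?thesis using D(3) D_le by linarith
    qed
    have "measure lebesgue G \<le> \<eta>" if "\<eta> > 0" for \<eta>
    proof -
      obtain n :: nat where n: "2 / \<eta> < real n" using reals_Archimedean2 by blast
      then have "0 < real n" using that by (smt (verit) divide_pos_pos)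
      then have "1 / real n \<le> \<eta> / 2" using n that by (simp add: field_simps)
      then show ?thesis using G_le[of "real n" "\<eta> / 2"] \<open>0 < real n\<close> that by auto
    qed
    then have "measure lebesgue G \<le> 0" by (rule field_le_epsilon) simp
    then have "measure lebesgue G = 0" by (simp add: measure_le_0_iff)
    then show ?thesis using G by (simp add: negligible_iff_measure G_def)
  qed
  have "negligible (E \<inter> {a<..<b})"
  proof (subst locally_negligible_alt, rule ballI)
    fix x assume x: "x \<in> E \<inter> {a<..<b}"
    define c where "c = max a (x - \<delta>/3)"
    define d where "d = min b (x + \<delta>/3)"
    have cd: "{c<..<d} \<subseteq> {a<..<b}" "d - c < \<delta>" "c < d" "x \<in> {c<..<d}"
    proof -
      have "a \<le> c" "x - \<delta>/3 \<le> c" "c < x" "d \<le> b" "d \<le> x + \<delta>/3" "x < d"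
        using x \<delta>(1) by (simp_all add: c_def d_def)
      then show "{c<..<d} \<subseteq> {a<..<b}" "d - c < \<delta>" "c < d" "x \<in> {c<..<d}"
        using \<delta>(1) by (force, linarith+, simp)
    qed
    have "openin (top_of_set (E \<inter> {a<..<b})) (E \<inter> {a<..<b} \<inter> {c<..<d})"
      by (intro openin_open_Int) simp
    moreover have "E \<inter> {a<..<b} \<inter> {c<..<d} = E \<inter> {c<..<d}" using cd(1) by blast
    ultimately show "\<exists>U. openin (top_of_set (E \<inter> {a<..<b})) U \<and> x \<in> U \<and> negligible U"
      using small[OF cd(1-3)] cd(4) x by (intro exI[of _ "E \<inter> {c<..<d}"]) auto
  qed
  then show ?thesis by (simp add: E_def)
qed

text \<open>
  The hypotheses say that the slopes over short intervals around \<open>x\<close> stay bounded and do not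
  oscillate, so they converge to a limit \<open>L\<close>. Continuity allows one endpoint to move to \<open>x\<close>,
  which turns the two-sided slopes into difference quotients at \<open>x\<close>.
\<close>

lemma differentiable_if_slopes_converge:
  fixes f :: "real \<Rightarrow> real"
  assumes cont: "isCont f x"
    and lu: "\<And>p q. p \<in> \<rat> \<Longrightarrow> q \<in> \<rat> \<Longrightarrow> p < q \<Longrightarrow>
        x \<notin> vitali_points (\<lambda>u v. f v - f u < p * (v - u)) \<or> x \<notin> vitali_points (\<lambda>u v. q * (v - u) < f v - f u)"
    and bd: "q0 \<in> \<rat>" "x \<notin> vitali_points (\<lambda>u v. q0 * (v - u) < \<bar>f v - f u\<bar>)"
  shows "f differentiable (at x)"
proof -
  \<comment> \<open>The numbers that eventually bound the slopes from below and from above.\<close>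
  define lb where "lb p \<longleftrightarrow> (\<exists>d>0. \<forall>u v. u < x \<and> x < v \<and> v - u < d \<longrightarrow> p * (v - u) \<le> f v - f u)" for p
  define ub where "ub q \<longleftrightarrow> (\<exists>d>0. \<forall>u v. u < x \<and> x < v \<and> v - u < d \<longrightarrow> f v - f u \<le> q * (v - u))" for q
  have lbI: "x \<notin> vitali_points (\<lambda>u v. f v - f u < p * (v - u)) \<Longrightarrow> lb p" for p
    unfolding lb_def vitali_points_def mem_Collect_eq by (meson not_le)
  have ubI: "x \<notin> vitali_points (\<lambda>u v. q * (v - u) < f v - f u) \<Longrightarrow> ub q" for q
    unfolding ub_def vitali_points_def mem_Collect_eq by (meson not_le)
  have lb_le_ub: "p \<le> q" if "lb p" "ub q" for p q
  proof -
    obtain d e where d: "d > 0" "\<And>u v. u < x \<Longrightarrow> x < v \<Longrightarrow> v - u < d \<Longrightarrow> p * (v - u) \<le> f v - f u"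
      and e: "e > 0" "\<And>u v. u < x \<Longrightarrow> x < v \<Longrightarrow> v - u < e \<Longrightarrow> f v - f u \<le> q * (v - u)"
      using \<open>lb p\<close> \<open>ub q\<close> unfolding lb_def ub_def by meson
    define h where "h = min d e / 3"
    have h: "h > 0" "2 * h < d" "2 * h < e" using d(1) e(1) by (auto simp: h_def min_def)
    have eq: "x + h - (x - h) = 2 * h" by simp
    have "p * (2 * h) \<le> f (x + h) - f (x - h)"
      using d(2)[of "x - h" "x + h", unfolded eq] h by simp
    also have "\<dots> \<le> q * (2 * h)"
      using e(2)[of "x - h" "x + h", unfolded eq] h by simp
    finally have "p * (2 * h) \<le> q * (2 * h)" .
    then show ?thesis using h(1) by simp
  qed
  obtain d0 where d0: "d0 > 0" "\<And>u v. u < x \<Longrightarrow> x < v \<Longrightarrow> v - u < d0 \<Longrightarrow> \<bar>f v - f u\<bar> \<le> q0 * (v - u)"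
    using bd(2) unfolding vitali_points_def mem_Collect_eq by (meson not_le)
  have "lb (- q0)" unfolding lb_def using d0 by (intro exI[of _ d0]) (auto simp: abs_le_iff minus_le_iff)
  have "ub q0" unfolding ub_def using d0 by (intro exI[of _ d0]) (auto simp: abs_le_iff minus_le_iff)
  define L where "L = Sup {p. lb p}"
  have bdd: "bdd_above {p. lb p}" using lb_le_ub[OF _ \<open>ub q0\<close>] by (intro bdd_aboveI[of _ q0]) simp
  have L: "lb (L - e) \<and> ub (L + e)" if e: "e > 0" for e
  proof
    obtain p where "lb p" "L - e < p"
      using less_cSupD[of "{p. lb p}" "L - e"] \<open>lb (- q0)\<close> e by (auto simp: L_def)
    then obtain d where "d > 0" "\<And>u v. u < x \<Longrightarrow> x < v \<Longrightarrow> v - u < d \<Longrightarrow> p * (v - u) \<le> f v - f u"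
      unfolding lb_def by blast
    moreover have "(L - e) * (v - u) \<le> p * (v - u)" if "u < x" "x < v" for u v
      using that \<open>L - e < p\<close> by (intro mult_right_mono) auto
    ultimately show "lb (L - e)" unfolding lb_def by (meson order_trans)
    obtain p where p: "p \<in> \<rat>" "L < p" "p < L + e / 2" using Rats_dense_in_real[of L "L + e / 2"] e by auto
    obtain q where q: "q \<in> \<rat>" "L + e / 2 < q" "q < L + e" using Rats_dense_in_real[of "L + e / 2" "L + e"] e by auto
    have "\<not> lb p" using cSup_upper[OF _ bdd, of p] p(2) by (auto simp: L_def)
    then have "ub q" using lu[OF p(1) q(1)] p(3) q(2) lbI ubI by force
    then obtain d where "d > 0" "\<And>u v. u < x \<Longrightarrow> x < v \<Longrightarrow> v - u < d \<Longrightarrow> f v - f u \<le> q * (v - u)"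
      unfolding ub_def by blast
    moreover have "q * (v - u) \<le> (L + e) * (v - u)" if "u < x" "x < v" for u v
      using that q(3) by (intro mult_right_mono) auto
    ultimately show "ub (L + e)" unfolding ub_def by (meson order_trans)
  qed
  have est: "\<exists>d>0. \<forall>y. \<bar>y - x\<bar> < d \<longrightarrow> \<bar>f y - f x - L * (y - x)\<bar> \<le> e * \<bar>y - x\<bar>" if "e > 0" for e
  proof -
    have "\<exists>d>0. \<forall>u v. u < x \<and> x < v \<and> v - u < d \<longrightarrow> \<bar>f v - f u - L * (v - u)\<bar> \<le> e * (v - u)"
    proof -
      obtain d1 d2 where d1: "d1 > 0" "\<And>u v. u < x \<Longrightarrow> x < v \<Longrightarrow> v - u < d1 \<Longrightarrow> (L - e) * (v - u) \<le> f v - f u"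
        and d2: "d2 > 0" "\<And>u v. u < x \<Longrightarrow> x < v \<Longrightarrow> v - u < d2 \<Longrightarrow> f v - f u \<le> (L + e) * (v - u)"
        using L[OF \<open>e > 0\<close>] unfolding lb_def ub_def by meson
      have "\<bar>f v - f u - L * (v - u)\<bar> \<le> e * (v - u)" if uv: "u < x" "x < v" "v - u < min d1 d2" for u v
        using d1(2)[OF uv(1,2)] d2(2)[OF uv(1,2)] uv(3) by (simp add: abs_le_iff algebra_simps)
      moreover have "min d1 d2 > 0" using d1(1) d2(1) by simp
      ultimately show ?thesis by blast
    qed
    then obtain d where d: "d > 0" "\<And>u v. u < x \<Longrightarrow> x < v \<Longrightarrow> v - u < d \<Longrightarrow> \<bar>f v - f u - L * (v - u)\<bar> \<le> e * (v - u)"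
      by blast
    have lims: "((\<lambda>u. \<bar>f y - f u - L * (y - u)\<bar>) \<longlongrightarrow> \<bar>f y - f x - L * (y - x)\<bar>) (at x within S)"
      "((\<lambda>u. \<bar>f u - f y - L * (u - y)\<bar>) \<longlongrightarrow> \<bar>f x - f y - L * (x - y)\<bar>) (at x within S)"
      "((\<lambda>u. e * (y - u)) \<longlongrightarrow> e * (y - x)) (at x within S)" 
      "((\<lambda>u. e * (u - y)) \<longlongrightarrow> e * (x - y)) (at x within S)" for y S
      using cont[unfolded isCont_def, THEN tendsto_within_subset, of S]
      by (auto intro!: tendsto_intros)
    have "\<bar>f y - f x - L * (y - x)\<bar> \<le> e * \<bar>y - x\<bar>" if y: "\<bar>y - x\<bar> < d" for y
    proof (cases y x rule: linorder_cases)
      case less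
      have "\<forall>\<^sub>F v in at_right x. \<bar>f v - f y - L * (v - y)\<bar> \<le> e * (v - y)"
        unfolding eventually_at_right_field using y less d by (intro exI[of _ "y + d"]) auto
      then have "\<bar>f x - f y - L * (x - y)\<bar> \<le> e * (x - y)"
        by (intro tendsto_le[OF _ lims(4) lims(2), of "{x<..}" y]) (simp_all add: trivial_limit_at_right_real)
      then show ?thesis using less by (simp add: abs_le_iff algebra_simps)
    next
      case greater
      have "\<forall>\<^sub>F u in at_left x. \<bar>f y - f u - L * (y - u)\<bar> \<le> e * (y - u)"
        unfolding eventually_at_left_field using y greater d by (intro exI[of _ "y - d"]) auto
      then have "\<bar>f y - f x - L * (y - x)\<bar> \<le> e * (y - x)"
        by (intro tendsto_le[OF _ lims(3) lims(1), of "{..<x}" y]) (simp_all add: trivial_limit_at_left_real)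
      then show ?thesis using greater by simp
    qed simp
    then show ?thesis using d(1) by blast
  qed
  have "(f has_derivative (\<lambda>h. L * h)) (at x)"
    unfolding has_derivative_at_alt using est by (auto intro!: bounded_linear_mult_right)
  then show ?thesis by (auto simp: differentiable_def)
qed

text \<open>
  Non-differentiability is due to oscillating or to unbounded slopes. Restricting the slopes
  that are compared to rational values keeps the union of exceptional sets countable.
\<close>

lemma AC_loc_differentiable_ae:
  assumes f: "f \<in> AC_loc UNIV"
  shows "negligible {x. \<not> f differentiable (at x)}"
proof -
  define N where "N a b = (\<Union>p\<in>\<rat>. \<Union>q\<in>\<rat> \<inter> {p<..}. vitali_points (\<lambda>u v. f v - f u < p * (v - u))
      \<inter> vitali_points (\<lambda>u v. q * (v - u) < f v - f u) \<inter> {a<..<b})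
    \<union> (\<Inter>q\<in>\<rat>. vitali_points (\<lambda>u v. q * (v - u) < \<bar>f v - f u\<bar>)) \<inter> {a<..<b}" for a b
  have ac: "f \<in> AC {a..b}" if "a \<le> b" for a b
    using f that by (simp add: AC_loc_def)
  have N: "negligible (N a b)" if "a \<le> b" for a b
    unfolding N_def
  proof (intro negligible_Un negligible_countable_Union)
    show "countable ((\<lambda>p. \<Union>q\<in>\<rat> \<inter> {p<..}. vitali_points (\<lambda>u v. f v - f u < p * (v - u))
      \<inter> vitali_points (\<lambda>u v. q * (v - u) < f v - f u) \<inter> {a<..<b}) ` \<rat>)"
      by (intro countable_image countable_rat)
    fix X assume "X \<in> (\<lambda>p. \<Union>q\<in>\<rat> \<inter> {p<..}. vitali_points (\<lambda>u v. f v - f u < p * (v - u))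
      \<inter> vitali_points (\<lambda>u v. q * (v - u) < f v - f u) \<inter> {a<..<b}) ` \<rat>"
    then obtain p where X: "X = (\<Union>q\<in>\<rat> \<inter> {p<..}. vitali_points (\<lambda>u v. f v - f u < p * (v - u))
      \<inter> vitali_points (\<lambda>u v. q * (v - u) < f v - f u) \<inter> {a<..<b})" by blast
    show "negligible X"
      unfolding X
    proof (rule negligible_countable_Union)
      show "countable ((\<lambda>q. vitali_points (\<lambda>u v. f v - f u < p * (v - u))
        \<inter> vitali_points (\<lambda>u v. q * (v - u) < f v - f u) \<inter> {a<..<b}) ` (\<rat> \<inter> {p<..}))"
        by (intro countable_image countable_Int1 countable_rat)
    qed (use slopes_above_below_negligible[OF ac[OF that]] in auto)
  qed (rule infinite_slopes_negligible[OF ac[OF that]])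
  have "{x. \<not> f differentiable (at x)} \<subseteq> (\<Union>n. N (- real n) (real n))"
  proof
    fix x assume x: "x \<in> {x. \<not> f differentiable (at x)}"
    obtain n where n: "\<bar>x\<bar> < real n" using reals_Archimedean2 by blast
    then have xin: "x \<in> {- real n<..<real n}" by auto
    have "isCont f x"
      using continuous_on_interior[OF AC_continuous_on[OF ac[of "- real n" "real n"]]] xin by simp
    have "x \<in> N (- real n) (real n)"
    proof (rule ccontr)
      assume "x \<notin> N (- real n) (real n)"
      then have lu: "x \<notin> vitali_points (\<lambda>u v. f v - f u < p * (v - u)) \<or> x \<notin> vitali_points (\<lambda>u v. q * (v - u) < f v - f u)"
        if "p \<in> \<rat>" "q \<in> \<rat>" "p < q" for p q
        using that xin unfolding N_def by blast
      obtain q0 where "q0 \<in> \<rat>" "x \<notin> vitali_points (\<lambda>u v. q0 * (v - u) < \<bar>f v - f u\<bar>)"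
        using \<open>x \<notin> N _ _\<close> xin unfolding N_def by blast
      from differentiable_if_slopes_converge[OF \<open>isCont f x\<close> lu this] x show False by blast
    qed
    then show "x \<in> (\<Union>n. N (- real n) (real n))" by blast
  qed
  moreover have "negligible (\<Union>n. N (- real n) (real n))"
    by (rule negligible_countable_Union) (auto intro: N)
  ultimately show ?thesis by (rule negligible_subset[rotated])
qed

section \<open>The fundamental theorem of calculus\<close>

text \<open>
  The same interval can occur with several tags in a tagged partial division only if its
  interior is empty.
\<close>

lemma sum_tagged_partial_division_snd:
  assumes p: "p tagged_partial_division_of S" and g: "\<And>u::real. g {u} = (0::real)"
  shows "(\<Sum>(x,k)\<in>p. g k) = (\<Sum>k\<in>snd ` p. g k)"
proof -
  \<comment> \<open>An empty box is degenerate too, but \<open>g {}\<close> is arbitrary: for increments it involves the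
     unspecified value \<open>Sup {}\<close>. Members of \<open>p\<close> contain their tags, so it does not occur.\<close>
  let ?g = "\<lambda>k. if k = {} then 0 else g k"
  have *: "(\<Sum>(x,k)\<in>p. ?g k) = (\<Sum>k\<in>snd ` p. ?g k)"
  proof (rule sum.over_tagged_division_lemma[OF tagged_partial_division_of_Union_self[OF p]])
    fix u v :: real assume "box u v = {}"
    then show "?g (cbox u v) = 0" using g by (cases "u = v") (auto simp: not_less)
  qed
  have ne: "k \<noteq> {}" if "(x,k) \<in> p" for x k
    using tagged_partial_division_ofD(2)[OF p that] by blast
  have "(\<Sum>(x,k)\<in>p. ?g k) = (\<Sum>(x,k)\<in>p. g k)"
    using ne by (intro sum.cong) auto
  moreover have "(\<Sum>k\<in>snd ` p. ?g k) = (\<Sum>k\<in>snd ` p. g k)"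
    using ne by (intro sum.cong) auto
  ultimately show ?thesis using * by simp
qed

text \<open>
  The gauge is chosen in two ways. At a point of differentiability it makes the straddle
  estimate hold, so that the increment of \<open>f\<close> over an interval with this tag is close to its
  derivative times the length. At a tag in the exceptional null set it keeps the interval inside
  an open set \<open>U\<close> of measure below \<open>\<delta>\<close>; the increments over all intervals with such tags then sum to
  less than \<open>e / 2\<close> by absolute continuity, while the integrand is set to \<open>0\<close> there.
\<close>

lemma AC_has_integral_derivative:
  assumes f: "f \<in> AC {a..b}" and "a \<le> b" and N: "negligible N"
    and D: "\<And>x. x \<in> {a..b} - N \<Longrightarrow> (f has_real_derivative g x) (at x)"
  shows "(g has_integral (f b - f a)) {a..b}"
proof -
  define g0 where "g0 x = (if x \<in> N then 0 else g x)" for x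
  have "(g0 has_integral (f b - f a)) {a..b}"
    unfolding has_integral_real
  proof (intro allI impI)
    fix e :: real assume "e > 0"
    obtain \<delta> where \<delta>: "\<delta> > 0" "ac_bound f {a..b} (e/2) \<delta>"
      using f AC_iff_ac_bound \<open>e > 0\<close> half_gt_zero by blast
    obtain U where U: "open U" "N \<subseteq> U" "U - N \<in> lmeasurable" "emeasure lebesgue (U - N) < ennreal \<delta>"
      using sets_lebesgue_outer_open[OF negligible_imp_sets[OF N] \<delta>(1)] .
    have Ul: "U \<in> lmeasurable" "measure lebesgue U < \<delta>"
    proof -
      have eq: "U = (U - N) \<union> N" using U(2) by blast
      show "U \<in> lmeasurable" by (subst eq) (intro fmeasurable.Un U(3) negligible_imp_measurable[OF N])
      have "measure lebesgue U = measure lebesgue (U - N)"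
        using U(3) negligible_imp_measure0[OF N] measure_Un_null_set[of "U - N" lebesgue N] N eq
        by (auto simp: negligible_iff_null_sets fmeasurableD)
      then show "measure lebesgue U < \<delta>"
        using U(3,4) \<delta>(1) by (simp add: emeasure_eq_measure2 ennreal_less_iff)
    qed
    \<comment> \<open>The denominator has the summand \<open>1\<close> to cover the case \<open>a = b\<close> and to make the estimate strict.\<close>
    define c where "c = e / (2 * (b - a + 1))"
    have c: "c > 0" "c * (b - a) < e / 2" using \<open>e > 0\<close> \<open>a \<le> b\<close> by (auto simp: c_def field_simps)
    have "\<exists>d>0. (x \<in> {a..b} - N \<longrightarrow> (\<forall>y. \<bar>y - x\<bar> < d \<longrightarrow> \<bar>f y - f x - g x * (y - x)\<bar> \<le> c * \<bar>y - x\<bar>))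
        \<and> (x \<in> N \<longrightarrow> ball x d \<subseteq> U)" for x
    proof (cases "x \<in> N")
      case True
      then show ?thesis using U(1,2) open_contains_ball[of U] by auto
    next
      case False
      show ?thesis
      proof (cases "x \<in> {a..b}")
        case True
        then have "(f has_derivative (\<lambda>h. g x * h)) (at x)"
          using D[of x] False by (simp add: has_field_derivative_def)
        then show ?thesis using False c(1) unfolding has_derivative_at_alt by force
      qed (use False in \<open>auto intro: exI[of _ 1]\<close>)
    qed
    then obtain d where d: "\<And>x. d x > 0"
      "\<And>x y. x \<in> {a..b} - N \<Longrightarrow> \<bar>y - x\<bar> < d x \<Longrightarrow> \<bar>f y - f x - g x * (y - x)\<bar> \<le> c * \<bar>y - x\<bar>"
      "\<And>x. x \<in> N \<Longrightarrow> ball x (d x) \<subseteq> U" by metis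
    show "\<exists>\<gamma>. gauge \<gamma> \<and> (\<forall>p. p tagged_division_of {a..b} \<and> \<gamma> fine p \<longrightarrow>
        norm ((\<Sum>(x,k)\<in>p. measure lborel k *\<^sub>R g0 x) - (f b - f a)) < e)"
    proof (intro exI[of _ "\<lambda>x. ball x (d x)"] conjI allI impI)
      show "gauge (\<lambda>x. ball x (d x))" using d(1) by (intro gauge_ball_dependent) auto
      fix p assume p: "p tagged_division_of {a..b} \<and> (\<lambda>x. ball x (d x)) fine p"
      then have pt: "p tagged_partial_division_of {a..b}" by (simp add: tagged_division_of_def)
      note p' = tagged_division_ofD[OF conjunct1[OF p]]
      define P1 where "P1 = {xk \<in> p. fst xk \<in> N}"
      define P2 where "P2 = {xk \<in> p. fst xk \<notin> N}"
      have P12: "p = P1 \<union> P2" "P1 \<inter> P2 = {}" "finite P1" "finite P2" "P1 \<subseteq> p" "P2 \<subseteq> p"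
        using p'(1) by (auto simp: P1_def P2_def)
      have form: "\<exists>u v. k = {u..v} \<and> u \<le> x \<and> x \<le> v \<and> x \<in> {a..b} \<and> k \<subseteq> ball x (d x)" if xk: "(x,k) \<in> p" for x k
      proof -
        obtain u v where "k = {u..v}" using p'(4)[OF xk] by auto
        then show ?thesis using p'(2,3)[OF xk] fineD[OF conjunct2[OF p] xk] by auto
      qed
      have fba: "f b - f a = (\<Sum>(x,k)\<in>p. incr f k)"
        unfolding incr_def by (rule additive_tagged_division_1[OF \<open>a \<le> b\<close> conjunct1[OF p], symmetric])
      have ba: "b - a = (\<Sum>(x,k)\<in>p. measure lborel k)"
        using additive_content_tagged_division[of p a b] p \<open>a \<le> b\<close> by simp
      have "\<bar>\<Sum>(x,k)\<in>P2. measure lborel k * g0 x - incr f k\<bar> \<le> (\<Sum>(x,k)\<in>P2. c * measure lborel k)"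
        unfolding split_def
      proof (rule order_trans[OF sum_abs sum_mono])
        fix xk assume xk: "xk \<in> P2"
        obtain x k where [simp]: "xk = (x,k)" by (metis surj_pair)
        have mem: "(x,k) \<in> p" "x \<notin> N" using xk by (auto simp: P2_def)
        obtain u v where uv: "k = {u..v}" "u \<le> x" "x \<le> v" "x \<in> {a..b}" "{u..v} \<subseteq> ball x (d x)"
          using form[OF mem(1)] by blast
        then have "u \<in> ball x (d x)" "v \<in> ball x (d x)"
          using subsetD[OF uv(5), of u] subsetD[OF uv(5), of v] by simp_all
        then have "\<bar>f u - f x - g x * (u - x)\<bar> \<le> c * \<bar>u - x\<bar>" "\<bar>f v - f x - g x * (v - x)\<bar> \<le> c * \<bar>v - x\<bar>"
          using uv mem d(2)[of x u] d(2)[of x v] by (simp_all add: dist_real_def abs_minus_commute)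
        then have "\<bar>(v - u) * g x - (f v - f u)\<bar> \<le> c * (v - u)"
          using uv(2,3) by (simp add: abs_le_iff algebra_simps)
        then show "\<bar>measure lborel (snd xk) * g0 (fst xk) - incr f (snd xk)\<bar> \<le> c * measure lborel (snd xk)"
          using uv(1-3) mem(2) by (simp add: g0_def)
      qed
      also have "\<dots> \<le> (\<Sum>(x,k)\<in>p. c * measure lborel k)"
        using P12 p'(1) c(1) by (intro sum_mono2) auto
      also have "\<dots> = c * (b - a)" unfolding ba by (simp add: sum_distrib_left split_def)
      finally have 1: "\<bar>\<Sum>(x,k)\<in>P2. measure lborel k * g0 x - incr f k\<bar> < e / 2" using c(2) by linarith
      have P1t: "P1 tagged_partial_division_of {a..b}"
        using tagged_partial_division_subset[OF pt P12(5)] .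
      note dv = partial_division_of_tagged_division[OF P1t]
      have "(\<Sum>k\<in>snd ` P1. measure lebesgue k) \<le> measure lebesgue U"
      proof (rule division_measure_mono[OF dv _ Ul(1)])
        have "k \<subseteq> U" if "(x,k) \<in> P1" for x k
          using form[of x k] that d(3)[of x] by (auto simp: P1_def)
        then show "\<Union>(snd ` P1) \<subseteq> U" by fastforce
      qed
      then have less: "(\<Sum>k\<in>snd ` P1. measure lebesgue k) < \<delta>" using Ul(2) by linarith
      have "\<bar>\<Sum>(x,k)\<in>P1. measure lborel k * g0 x - incr f k\<bar> = \<bar>\<Sum>(x,k)\<in>P1. incr f k\<bar>"
      proof -
        have "(\<Sum>(x,k)\<in>P1. measure lborel k * g0 x - incr f k) = (\<Sum>(x,k)\<in>P1. - incr f k)"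
          by (intro sum.cong) (auto simp: P1_def g0_def)
        then show ?thesis by (simp add: split_def sum_negf)
      qed
      also have "\<dots> = \<bar>\<Sum>k\<in>snd ` P1. incr f k\<bar>"
        by (subst sum_tagged_partial_division_snd[OF P1t]) (auto simp: incr_def)
      also have "\<dots> \<le> (\<Sum>k\<in>snd ` P1. \<bar>incr f k\<bar>)" by (rule sum_abs)
      also have "\<dots> < e / 2"
      proof (rule ac_bound_division[OF \<delta>(2) dv _ less])
        show "\<Union>(snd ` P1) \<subseteq> {a..b}" using tagged_partial_division_ofD(3)[OF P1t] by fastforce
      qed
      finally have 2: "\<bar>\<Sum>(x,k)\<in>P1. measure lborel k * g0 x - incr f k\<bar> < e / 2" .
      have "(\<Sum>(x,k)\<in>p. measure lborel k *\<^sub>R g0 x) - (f b - f a) = (\<Sum>(x,k)\<in>p. measure lborel k * g0 x - incr f k)"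
        unfolding fba by (simp add: split_def sum_subtractf)
      also have "\<dots> = (\<Sum>(x,k)\<in>P1. measure lborel k * g0 x - incr f k) + (\<Sum>(x,k)\<in>P2. measure lborel k * g0 x - incr f k)"
        using P12 by (simp add: sum.union_disjoint)
      finally show "norm ((\<Sum>(x,k)\<in>p. measure lborel k *\<^sub>R g0 x) - (f b - f a)) < e"
        using 1 2 by simp
    qed
  qed
  then show ?thesis
    by (rule has_integral_spike[OF N, rotated]) (auto simp: g0_def)
qed

text \<open>
  The integral is a gauge integral, so this makes no claim yet about the integrability of
  the absolute value of the derivative.
\<close>

lemma AC_loc_has_integral_deriv:
  assumes f: "f \<in> AC_loc UNIV" and "a \<le> b"
  shows "(deriv f has_integral (f b - f a)) {a..b}"
proof (rule AC_has_integral_derivative[OF _ \<open>a \<le> b\<close> AC_loc_differentiable_ae[OF f]])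
  show "f \<in> AC {a..b}" using f \<open>a \<le> b\<close> by (simp add: AC_loc_def)
qed (simp add: DERIV_deriv_iff_real_differentiable)

section \<open>Absolute continuity from the derivative\<close>

lemma nn_integral_abs_eq_integral:
  fixes h :: "real \<Rightarrow> real"
  assumes "h absolutely_integrable_on S"
  shows "(\<integral>\<^sup>+x\<in>S. ennreal \<bar>h x\<bar> \<partial>lebesgue) = ennreal (integral S (\<lambda>x. \<bar>h x\<bar>))"
proof -
  have "(\<lambda>x. \<bar>h x\<bar>) integrable_on S" using assms by (simp add: absolutely_integrable_on_def)
  then show ?thesis
    using nn_integral_has_integral_lebesgue'[of S "\<lambda>x. \<bar>h x\<bar>"] by (auto simp: nn_integral_completion integrable_integral)
qed

text \<open>
  The integral over \<open>K\<close> depends on \<open>K\<close> absolutely continuously with respect to Lebesgue measure, even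
  though \<open>g\<close> need not be integrable over the whole line. Otherwise there are sets \<open>K n\<close> of measure below
  \<open>(1/2)^n\<close> with integrals at least \<open>\<epsilon>\<close>. Their union has finite measure, so the integral
  over it is finite because \<open>g\<close> belongs to \<^const>\<open>L1_G\<close>, and continuity from above applies to the tails. The
  limit superior is then a null set (Borel-Cantelli) over which the integral is at least \<open>\<epsilon>\<close>, which is absurd.
\<close>

lemma small_measure_small_integral:
  assumes g: "g \<in> L1_G" and "\<epsilon> > 0"
  shows "\<exists>\<delta>>0. \<forall>K\<in>sets lebesgue. emeasure lebesgue K < ennreal \<delta> \<longrightarrow> (\<integral>\<^sup>+x\<in>K. ennreal \<bar>g x\<bar> \<partial>lebesgue) < ennreal \<epsilon>"
proof (rule ccontr)
  assume "\<not> ?thesis"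
  then have neg: "\<exists>K\<in>sets lebesgue. emeasure lebesgue K < ennreal \<delta> \<and> ennreal \<epsilon> \<le> (\<integral>\<^sup>+x\<in>K. ennreal \<bar>g x\<bar> \<partial>lebesgue)"
    if "\<delta> > 0" for \<delta> using that by (meson not_less)
  have "\<exists>K\<in>sets lebesgue. emeasure lebesgue K < ennreal ((1/2)^n) \<and> ennreal \<epsilon> \<le> (\<integral>\<^sup>+x\<in>K. ennreal \<bar>g x\<bar> \<partial>lebesgue)" for n :: nat
    by (rule neg) simp
  then obtain K where K: "\<And>n::nat. K n \<in> sets lebesgue" "\<And>n. emeasure lebesgue (K n) < ennreal ((1/2)^n)"
    "\<And>n. ennreal \<epsilon> \<le> (\<integral>\<^sup>+x\<in>K n. ennreal \<bar>g x\<bar> \<partial>lebesgue)" by metis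
  have gm [measurable]: "g \<in> borel_measurable lebesgue" using g by (simp add: L1_G_def)
  define \<nu> where "\<nu> = density lebesgue (\<lambda>x. ennreal \<bar>g x\<bar>)"
  have \<nu>: "emeasure \<nu> A = (\<integral>\<^sup>+x\<in>A. ennreal \<bar>g x\<bar> \<partial>lebesgue)" if "A \<in> sets lebesgue" for A
    unfolding \<nu>_def using that by (intro emeasure_density) auto
  have sets_\<nu>: "sets \<nu> = sets lebesgue" by (simp add: \<nu>_def)
  have fin: "emeasure lebesgue (K n) < \<infinity>" for n
    using K(2)[of n] less_trans ennreal_less_top by (metis infinity_ennreal_def)
  have mK: "measure lebesgue (K n) \<le> (1/2)^n" for n
    using K(2)[of n] by (simp add: measure_def enn2real_leI)
  have sumK: "summable (\<lambda>n. measure lebesgue (K n))"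
    by (rule summable_comparison_test'[of "\<lambda>n. (1/2)^n" 0]) (use mK in \<open>auto intro: summable_geometric\<close>)
  have null: "limsup K \<in> null_sets lebesgue"
    by (rule borel_cantelli_limsup1[OF K(1) fin sumK])
  define A where "A n = (\<Union>k\<in>{n..}. K k)" for n
  have A: "A n \<in> sets lebesgue" for n unfolding A_def using K(1) by auto
  have Afin: "emeasure lebesgue (A n) < \<infinity>" for n
  proof -
    have "A n \<subseteq> (\<Union>k. K k)" by (auto simp: A_def)
    then have "emeasure lebesgue (A n) \<le> emeasure lebesgue (\<Union>k. K k)"
      using K(1) by (intro emeasure_mono) auto
    also have "\<dots> < \<infinity>"
      using emeasure_union_summable[OF K(1) fin sumK] by simp
    finally show ?thesis .
  qed
  have finA: "emeasure \<nu> (A n) \<noteq> \<infinity>" for n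
  proof -
    have "(\<integral>\<^sup>+x\<in>A n. ennreal \<bar>g x\<bar> \<partial>lebesgue) < \<infinity>"
      using g A[of n] Afin[of n] unfolding L1_G_def by blast
    then show ?thesis unfolding \<nu>[OF A] by simp
  qed
  have "(INF n. emeasure \<nu> (A n)) = emeasure \<nu> (\<Inter>n. A n)"
  proof (rule INF_emeasure_decseq)
    show "range A \<subseteq> sets \<nu>" using A sets_\<nu> by auto
    show "decseq A" by (force simp: A_def decseq_def)
  qed (rule finA)
  also have "(\<Inter>n. A n) = limsup K" by (simp add: limsup_INF_SUP A_def)
  also have "emeasure \<nu> (limsup K) = 0"
    using null null_sets_density_iff[of "\<lambda>x. ennreal \<bar>g x\<bar>" lebesgue "limsup K"]
    by (subst \<nu>) (auto intro!: nn_integral_null_set)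
  finally have "(INF n. emeasure \<nu> (A n)) = 0" .
  moreover have "ennreal \<epsilon> \<le> emeasure \<nu> (A n)" for n
  proof -
    have "emeasure \<nu> (K n) \<le> emeasure \<nu> (A n)"
      using A sets_\<nu> by (intro emeasure_mono) (auto simp: A_def)
    then show ?thesis using K(3)[of n] \<nu>[OF K(1)] by (metis order_trans)
  qed
  then have "ennreal \<epsilon> \<le> (INF n. emeasure \<nu> (A n))" by (rule INF_greatest)
  ultimately show False using \<open>\<epsilon> > 0\<close> by simp
qed

text \<open>
  The fundamental theorem bounds each increment of \<open>f\<close> by the integral of \<open>\<bar>deriv f\<bar>\<close> over the
  interval; summing over disjoint intervals gives the integral over their union, which is
  uniformly small.
\<close>

lemma AC_if_deriv_L1_G:
  assumes f: "f \<in> AC_loc UNIV" and g: "deriv f \<in> L1_G"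
  shows "f \<in> AC UNIV"
  unfolding AC_iff_ac_bound
proof (intro allI impI)
  fix \<epsilon> :: real assume "\<epsilon> > 0"
  then obtain \<delta> where \<delta>: "\<delta> > 0" "\<And>K. K \<in> sets lebesgue \<Longrightarrow> emeasure lebesgue K < ennreal \<delta> \<Longrightarrow>
      (\<integral>\<^sup>+x\<in>K. ennreal \<bar>deriv f x\<bar> \<partial>lebesgue) < ennreal \<epsilon>"
    using small_measure_small_integral[OF g] by blast
  have gm [measurable]: "deriv f \<in> borel_measurable lebesgue" using g by (simp add: L1_G_def)
  have le: "ennreal \<bar>f v - f u\<bar> \<le> (\<integral>\<^sup>+x\<in>{u<..<v}. ennreal \<bar>deriv f x\<bar> \<partial>lebesgue)" if "u < v" for u v
  proof -
    have "(\<integral>\<^sup>+x\<in>{u..v}. ennreal \<bar>deriv f x\<bar> \<partial>lebesgue) < \<infinity>"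
      using g unfolding L1_G_def by (auto simp: emeasure_lborel_Icc_eq)
    then have abs: "deriv f absolutely_integrable_on {u..v}"
      unfolding set_integrable_def
    proof (intro integrableI_bounded)
      show "(\<lambda>x. indicat_real {u..v} x *\<^sub>R deriv f x) \<in> borel_measurable lebesgue"
        by (intro borel_measurable_scaleR borel_measurable_indicator gm) simp
    qed (simp add: abs_mult ennreal_mult ennreal_indicator mult.commute)
    have "ennreal \<bar>f v - f u\<bar> = ennreal \<bar>integral {u..v} (deriv f)\<bar>"
      using AC_loc_has_integral_deriv[OF f, of u v] that by (simp add: integral_unique)
    also have "\<dots> \<le> ennreal (integral {u..v} (\<lambda>x. \<bar>deriv f x\<bar>))"
      using integral_norm_bound_integral[of "deriv f" "{u..v}" "\<lambda>x. \<bar>deriv f x\<bar>"] abs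
      by (intro ennreal_leI) (simp add: absolutely_integrable_on_def)
    also have "\<dots> = (\<integral>\<^sup>+x\<in>{u..v}. ennreal \<bar>deriv f x\<bar> \<partial>lebesgue)"
      by (rule nn_integral_abs_eq_integral[OF abs, symmetric])
    \<comment> \<open>The disjointness that is available later is that of the open intervals.\<close>
    also have "\<dots> = (\<integral>\<^sup>+x\<in>{u<..<v}. ennreal \<bar>deriv f x\<bar> \<partial>lebesgue)"
    proof (rule nn_integral_cong_AE)
      have "negligible {u,v}" by simp
      then have "AE x in lebesgue. x \<notin> {u,v}" by (metis AE_not_in negligible_iff_null_sets)
      then show "AE x in lebesgue. ennreal \<bar>deriv f x\<bar> * indicator {u..v} x = ennreal \<bar>deriv f x\<bar> * indicator {u<..<v} x"
        by eventually_elim (auto simp: indicator_def)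
    qed
    finally show ?thesis .
  qed
  have "ac_bound f UNIV \<epsilon> \<delta>"
    unfolding ac_bound_def
  proof (intro allI impI)
    fix n :: nat and x y :: "nat \<Rightarrow> real"
    assume xy: "\<forall>k\<in>{1..n}. x k < y k \<and> {x k..y k} \<subseteq> UNIV"
      and disj: "disjoint_family_on (\<lambda>k. {x k<..<y k}) {1..n}"
      and less: "(\<Sum>k=1..n. y k - x k) < \<delta>"
    define K where "K = (\<Union>k\<in>{1..n}. {x k<..<y k})"
    have "emeasure lebesgue K = (\<Sum>k=1..n. emeasure lebesgue {x k<..<y k})"
      unfolding K_def using disj by (intro sum_emeasure[symmetric]) auto
    also have "\<dots> = (\<Sum>k=1..n. ennreal (y k - x k))"
      using xy by (intro sum.cong refl) (auto simp: less_imp_le)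
    also have "\<dots> = ennreal (\<Sum>k=1..n. y k - x k)"
      using xy by (intro sum_ennreal) (auto simp: less_imp_le)
    also have "\<dots> < ennreal \<delta>" using less \<delta>(1) by (simp add: ennreal_lessI)
    finally have "(\<integral>\<^sup>+x\<in>K. ennreal \<bar>deriv f x\<bar> \<partial>lebesgue) < ennreal \<epsilon>"
      by (intro \<delta>(2)) (auto simp: K_def)
    moreover have "(\<Sum>k=1..n. ennreal \<bar>f (y k) - f (x k)\<bar>)
        \<le> (\<Sum>k=1..n. \<integral>\<^sup>+t\<in>{x k<..<y k}. ennreal \<bar>deriv f t\<bar> \<partial>lebesgue)"
      using xy le by (intro sum_mono) auto
    moreover have "\<dots> = (\<integral>\<^sup>+t\<in>K. ennreal \<bar>deriv f t\<bar> \<partial>lebesgue)"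
    proof -
      define \<nu> where "\<nu> = density lebesgue (\<lambda>x. ennreal \<bar>deriv f x\<bar>)"
      have \<nu>: "emeasure \<nu> A = (\<integral>\<^sup>+x\<in>A. ennreal \<bar>deriv f x\<bar> \<partial>lebesgue)" if "A \<in> sets lebesgue" for A
        unfolding \<nu>_def using that by (intro emeasure_density) auto
      have "(\<Sum>k=1..n. emeasure \<nu> {x k<..<y k}) = emeasure \<nu> K"
        unfolding K_def using disj by (intro sum_emeasure) (auto simp: \<nu>_def)
      then show ?thesis by (simp add: \<nu> K_def)
    qed
    ultimately have "(\<Sum>k=1..n. ennreal \<bar>f (y k) - f (x k)\<bar>) < ennreal \<epsilon>" by simp
    then have "ennreal (\<Sum>k=1..n. \<bar>f (y k) - f (x k)\<bar>) < ennreal \<epsilon>" by (simp add: sum_ennreal)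
    then show "(\<Sum>k=1..n. \<bar>f (y k) - f (x k)\<bar>) < \<epsilon>"
      by (subst (asm) ennreal_less_iff) (auto intro: sum_nonneg)
  qed
  then show "\<exists>\<delta>>0. ac_bound f UNIV \<epsilon> \<delta>" using \<delta>(1) by blast
qed

section \<open>Integrability of the derivative\<close>

lemma AC_UNIV_imp_AC_loc:
  assumes f: "f \<in> AC UNIV"
  shows "f \<in> AC_loc UNIV"
proof -
  have ac: "f \<in> AC {a..b}" for a b by (rule AC_mono[OF f]) simp
  have "isCont f x" for x
    using continuous_on_interior[OF AC_continuous_on[OF ac[of "x - 1" "x + 1"]]] by simp
  then have "f \<in> borel_measurable borel"
    by (intro borel_measurable_continuous_onI continuous_at_imp_continuous_on) simp
  then have "f \<in> borel_measurable (lebesgue_on UNIV)"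
    by (simp add: lebesgue_on_UNIV_eq measurable_completion)
  then show ?thesis using ac by (simp add: AC_loc_def)
qed

text \<open>
  The functions that have a gauge integral over a bounded interval are measurable there.
\<close>

lemma AC_loc_deriv_measurable:
  assumes f: "f \<in> AC_loc UNIV"
  shows "deriv f \<in> borel_measurable lebesgue"
proof (rule borel_measurable_LIMSEQ_real)
  show "(\<lambda>x. deriv f x * indicator {- real n..real n} x) \<in> borel_measurable lebesgue" for n
    by (rule has_integral_implies_lebesgue_measurable_real[OF AC_loc_has_integral_deriv[OF f]]) simp
  fix x :: real
  obtain N :: nat where N: "\<bar>x\<bar> \<le> real N" using real_arch_simple by blast
  have "\<forall>\<^sub>F n in sequentially. deriv f x * indicator {- real n..real n} x = deriv f x"
    unfolding eventually_sequentially
  proof (intro exI[of _ N] allI impI)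
    fix n assume "N \<le> n"
    then have "\<bar>x\<bar> \<le> real n" using N by linarith
    then show "deriv f x * indicator {- real n..real n} x = deriv f x" by (auto simp: abs_le_iff)
  qed
  then show "(\<lambda>n. deriv f x * indicator {- real n..real n} x) \<longlonglongrightarrow> deriv f x"
    by (rule tendsto_eventually)
qed

text \<open>
  By Henstock's lemma, for a fine tagged division the integrals of \<open>h\<close> over its intervals are close
  to the terms \<open>h x\<close> times length, so their absolute values sum to nearly the integral of \<open>\<bar>h\<bar>\<close>.
\<close>

lemma integral_abs_le_variation:
  fixes h :: "real \<Rightarrow> real"
  assumes h: "h absolutely_integrable_on {a..b}"
    and B: "\<And>d. d division_of {a..b} \<Longrightarrow> (\<Sum>k\<in>d. \<bar>integral k h\<bar>) \<le> B"
  shows "integral {a..b} (\<lambda>x. \<bar>h x\<bar>) \<le> B"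
proof (rule field_le_epsilon)
  fix e :: real assume "e > 0"
  have int: "h integrable_on cbox a b" "(\<lambda>x. \<bar>h x\<bar>) integrable_on cbox a b"
    using h by (auto simp: absolutely_integrable_on_def)
  obtain \<gamma>1 where \<gamma>1: "gauge \<gamma>1" "\<And>p. p tagged_division_of cbox a b \<Longrightarrow> \<gamma>1 fine p \<Longrightarrow>
      norm ((\<Sum>(x,k)\<in>p. measure lborel k *\<^sub>R \<bar>h x\<bar>) - integral (cbox a b) (\<lambda>x. \<bar>h x\<bar>)) < e / 2"
    using has_integralD[OF integrable_integral[OF int(2)] half_gt_zero[OF \<open>e > 0\<close>]] by blast
  obtain \<gamma>2 where \<gamma>2: "gauge \<gamma>2" "\<And>p. p tagged_partial_division_of cbox a b \<Longrightarrow> \<gamma>2 fine p \<Longrightarrow>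
      (\<Sum>(x,k)\<in>p. norm (measure lborel k *\<^sub>R h x - integral k h)) < e / 2"
    using Henstock_lemma[OF int(1) half_gt_zero[OF \<open>e > 0\<close>]] by blast
  obtain p where p: "p tagged_division_of cbox a b" "(\<lambda>x. \<gamma>1 x \<inter> \<gamma>2 x) fine p"
    using fine_division_exists[OF gauge_Int[OF \<gamma>1(1) \<gamma>2(1)]] by blast
  then have fine: "\<gamma>1 fine p" "\<gamma>2 fine p" by (auto simp: fine_Int)
  have pp: "p tagged_partial_division_of cbox a b" using p(1) by (simp add: tagged_division_of_def)
  have "integral {a..b} (\<lambda>x. \<bar>h x\<bar>) \<le> (\<Sum>(x,k)\<in>p. measure lborel k *\<^sub>R \<bar>h x\<bar>) + e / 2"
    using \<gamma>1(2)[OF p(1) fine(1)] unfolding real_norm_def box_real by linarith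
  also have "(\<Sum>(x,k)\<in>p. measure lborel k *\<^sub>R \<bar>h x\<bar>)
      \<le> (\<Sum>(x,k)\<in>p. \<bar>integral k h\<bar> + norm (measure lborel k *\<^sub>R h x - integral k h))"
  proof (rule sum_mono, safe)
    fix x and k :: "real set"
    have "measure lborel k *\<^sub>R \<bar>h x\<bar> = \<bar>measure lborel k * h x\<bar>" by (simp add: abs_mult)
    then show "measure lborel k *\<^sub>R \<bar>h x\<bar> \<le> \<bar>integral k h\<bar> + norm (measure lborel k *\<^sub>R h x - integral k h)"
      by simp
  qed
  also have "\<dots> = (\<Sum>(x,k)\<in>p. \<bar>integral k h\<bar>) + (\<Sum>(x,k)\<in>p. norm (measure lborel k *\<^sub>R h x - integral k h))"
    by (simp add: split_def sum.distrib)
  also have "(\<Sum>(x,k)\<in>p. \<bar>integral k h\<bar>) = (\<Sum>k\<in>snd ` p. \<bar>integral k h\<bar>)"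
    by (rule sum.over_tagged_division_lemma[OF p(1)]) (metis abs_zero content_eq_0_interior integral_null interior_cbox)
  also have "\<dots> \<le> B" using B[of "snd ` p"] division_of_tagged_division[OF p(1)] by simp
  finally show "integral {a..b} (\<lambda>x. \<bar>h x\<bar>) \<le> B + e" using \<gamma>2(2)[OF pp fine(2)] by linarith
qed

text \<open>
  On each interval of the division the integral of \<open>\<bar>deriv f\<bar>\<close> is finite and is nearly attained by the sum of
  \<open>\<bar>f v - f u\<bar>\<close> over some subdivision. All these subdivisions together consist of nonoverlapping
  intervals of total length below \<open>\<delta>\<close>, so absolute continuity bounds the whole by \<open>\<epsilon>\<close>.
\<close>

lemma nn_integral_deriv_elementary:
  assumes f: "f \<in> AC_loc UNIV" and ac: "ac_bound f UNIV \<epsilon> \<delta>"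
    and p: "p division_of W" and W: "measure lebesgue W < \<delta>"
  shows "(\<integral>\<^sup>+x\<in>W. ennreal \<bar>deriv f x\<bar> \<partial>lebesgue) \<le> ennreal \<epsilon>"
proof -
  have pW: "p division_of \<Union>p" "\<Union>p = W" "finite p" using p by auto
  have sum_p: "(\<Sum>k\<in>p. measure lebesgue k) = measure lebesgue W" by (rule content_division[OF p])
  have form: "\<exists>u v. k = {u..v} \<and> u \<le> v" if k: "k \<in> p" for k
  proof -
    obtain u v where "k = cbox u v" "k \<noteq> {}" using division_ofD(3,4)[OF p k] by blast
    then show ?thesis by auto
  qed
  have incr: "\<bar>integral K (deriv f)\<bar> = \<bar>incr f K\<bar>" if K: "K \<in> d" and d: "d division_of k" for K d k
  proof -
    obtain u v where "K = cbox u v" "K \<noteq> {}" using division_ofD(3,4)[OF d K] by blast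
    then show ?thesis using AC_loc_has_integral_deriv[OF f, of u v] by (auto simp: integral_unique)
  qed
  have abs: "deriv f absolutely_integrable_on k" if k: "k \<in> p" for k
  proof -
    obtain u v where uv: "k = cbox u v" "u \<le> v" using form[OF k] by auto
    have le: "measure lebesgue k < \<delta>"
      using member_le_sum[OF k, of "measure lebesgue"] pW(3) sum_p W by simp
    show ?thesis
      unfolding uv(1)
    proof (rule bounded_variation_absolutely_integrable_interval)
      show "deriv f integrable_on cbox u v"
        using AC_loc_has_integral_deriv[OF f uv(2)] by (auto simp: integrable_on_def)
      fix d assume d: "d division_of cbox u v"
      have "(\<Sum>K\<in>d. \<bar>incr f K\<bar>) < \<epsilon>"
        using content_division[OF d] le uv d by (intro ac_bound_division[OF ac]) auto
      then show "(\<Sum>K\<in>d. norm (integral K (deriv f))) \<le> \<epsilon>"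
        using incr[OF _ d] by (simp cong: sum.cong)
    qed
  qed
  have J_le: "(\<Sum>k\<in>p. integral k (\<lambda>x. \<bar>deriv f x\<bar>)) \<le> \<epsilon>"
  proof (rule field_le_epsilon)
    fix e :: real assume "e > 0"
    define \<eta> where "\<eta> = e / (real (card p) + 1)"
    have \<eta>: "\<eta> > 0" "real (card p) * \<eta> \<le> e" using \<open>e > 0\<close> by (auto simp: \<eta>_def field_simps)
    have "\<exists>d. d division_of k \<and> integral k (\<lambda>x. \<bar>deriv f x\<bar>) - \<eta> \<le> (\<Sum>K\<in>d. \<bar>incr f K\<bar>)" if k: "k \<in> p" for k
    proof (rule ccontr)
      assume neg: "\<not> ?thesis"
      obtain u v where uv: "k = {u..v}" "u \<le> v" using form[OF k] by blast
      have "integral {u..v} (\<lambda>x. \<bar>deriv f x\<bar>) \<le> integral k (\<lambda>x. \<bar>deriv f x\<bar>) - \<eta>"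
      proof (rule integral_abs_le_variation)
        show "deriv f absolutely_integrable_on {u..v}" using abs[OF k] uv by simp
        fix d assume d: "d division_of {u..v}"
        then have "(\<Sum>K\<in>d. \<bar>incr f K\<bar>) < integral k (\<lambda>x. \<bar>deriv f x\<bar>) - \<eta>" using neg uv by (meson not_le)
        then show "(\<Sum>K\<in>d. \<bar>integral K (deriv f)\<bar>) \<le> integral k (\<lambda>x. \<bar>deriv f x\<bar>) - \<eta>"
          using incr[OF _ d] by (simp cong: sum.cong)
      qed
      then show False using uv \<eta>(1) by simp
    qed
    then obtain d where d: "\<And>k. k \<in> p \<Longrightarrow> d k division_of k"
      "\<And>k. k \<in> p \<Longrightarrow> integral k (\<lambda>x. \<bar>deriv f x\<bar>) - \<eta> \<le> (\<Sum>K\<in>d k. \<bar>incr f K\<bar>)" by metis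
    have "(\<Sum>k\<in>p. \<Sum>K\<in>d k. \<bar>incr f K\<bar>) < \<epsilon>"
    proof (rule ac_bound_nested[OF ac pW(1)])
      show "d k division_of \<Union>(d k) \<and> \<Union>(d k) \<subseteq> k" if "k \<in> p" for k
        using d(1)[OF that] by auto
      show "(\<Sum>k\<in>p. \<Sum>c\<in>d k. measure lebesgue c) < \<delta>"
        using W sum_p content_division[OF d(1)] by (simp cong: sum.cong)
    qed simp
    moreover have "(\<Sum>k\<in>p. integral k (\<lambda>x. \<bar>deriv f x\<bar>) - \<eta>) \<le> (\<Sum>k\<in>p. \<Sum>K\<in>d k. \<bar>incr f K\<bar>)"
      by (intro sum_mono d(2))
    ultimately show "(\<Sum>k\<in>p. integral k (\<lambda>x. \<bar>deriv f x\<bar>)) \<le> \<epsilon> + e"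
      using \<eta>(2) by (simp add: sum_subtractf)
  qed
  define \<nu> where "\<nu> = density lebesgue (\<lambda>x. ennreal \<bar>deriv f x\<bar>)"
  have m: "(\<lambda>x. ennreal \<bar>deriv f x\<bar>) \<in> borel_measurable lebesgue"
    using AC_loc_deriv_measurable[OF f] by measurable
  have \<nu>: "emeasure \<nu> A = (\<integral>\<^sup>+x\<in>A. ennreal \<bar>deriv f x\<bar> \<partial>lebesgue)" if "A \<in> sets lebesgue" for A
    unfolding \<nu>_def using that m by (intro emeasure_density)
  have kL: "k \<in> sets lebesgue" if "k \<in> p" for k using form[OF that] by auto
  have "emeasure \<nu> (\<Union>k\<in>p. k) \<le> (\<Sum>k\<in>p. emeasure \<nu> k)"
    using pW(3) kL by (intro emeasure_subadditive_finite) (auto simp: \<nu>_def)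
  also have "\<dots> = (\<Sum>k\<in>p. ennreal (integral k (\<lambda>x. \<bar>deriv f x\<bar>)))"
    using \<nu>[OF kL] nn_integral_abs_eq_integral[OF abs] by (intro sum.cong) auto
  also have "\<dots> = ennreal (\<Sum>k\<in>p. integral k (\<lambda>x. \<bar>deriv f x\<bar>))"
    using abs by (intro sum_ennreal integral_nonneg) (auto simp: absolutely_integrable_on_def)
  also have "\<dots> \<le> ennreal \<epsilon>" using J_le by (rule ennreal_leI)
  finally show ?thesis
    using \<nu>[of W] lmeasurable_division[OF p] pW(2) by (simp add: fmeasurableD)
qed

text \<open>
  Let \<open>\<delta>\<close> belong to \<open>\<epsilon> = 1\<close>. Every open set of measure below \<open>\<delta>\<close> is an increasing union of finite
  unions of intervals, so the integral of \<open>\<bar>deriv f\<bar>\<close> over it is at most \<open>1\<close>. A set of finite measure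
  is covered by one such open set, which takes care of the part outside a large interval,
  and finitely many short intervals, which cover the large one.
\<close>

lemma deriv_L1_G_if_AC:
  assumes f: "f \<in> AC UNIV"
  shows "deriv f \<in> L1_G"
proof -
  have loc: "f \<in> AC_loc UNIV" by (rule AC_UNIV_imp_AC_loc[OF f])
  note gm = AC_loc_deriv_measurable[OF loc]
  obtain \<delta> where \<delta>: "\<delta> > 0" "ac_bound f UNIV 1 \<delta>" using f AC_iff_ac_bound zero_less_one by blast
  define \<nu> where "\<nu> = density lebesgue (\<lambda>x. ennreal \<bar>deriv f x\<bar>)"
  have m: "(\<lambda>x. ennreal \<bar>deriv f x\<bar>) \<in> borel_measurable lebesgue" using gm by measurable
  have \<nu>: "emeasure \<nu> A = (\<integral>\<^sup>+x\<in>A. ennreal \<bar>deriv f x\<bar> \<partial>lebesgue)" if "A \<in> sets lebesgue" for A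
    unfolding \<nu>_def using that m by (intro emeasure_density)
  have sets_\<nu> [simp]: "sets \<nu> = sets lebesgue" by (simp add: \<nu>_def)
  have open_le: "emeasure \<nu> U \<le> 1" if U: "open U" "emeasure lebesgue U < ennreal \<delta>" for U
  proof -
    obtain D where D: "countable D" "\<And>X. X \<in> D \<Longrightarrow> \<exists>a b. X = cbox a b" "\<Union>D = U"
      using open_countable_Union_open_cbox[OF U(1)] by metis
    show ?thesis
    proof (cases "D = {}")
      case False
      define h where "h = from_nat_into D"
      have h: "range h = D" using False D(1) by (simp add: h_def range_from_nat_into)
      define W where "W n = \<Union>(h ` {..n})" for n
      have UW: "U = (\<Union>n. W n)" unfolding W_def D(3)[symmetric] h[symmetric] by auto
      have bound: "W n \<in> sets \<nu>" "emeasure \<nu> (W n) \<le> 1" for n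
      proof -
        have "\<exists>a b. X = cbox a b" if "X \<in> h ` {..n}" for X
          using that h by (intro D(2)) auto
        then obtain p where p: "p division_of W n"
          using elementary_unions_intervals[of "h ` {..n}"] unfolding W_def by auto
        then have Wl: "W n \<in> lmeasurable" by (rule lmeasurable_division)
        have "emeasure lebesgue (W n) \<le> emeasure lebesgue U"
          using U(1) UW by (intro emeasure_mono) auto
        then have "emeasure lebesgue (W n) < ennreal \<delta>" using U(2) by (rule le_less_trans)
        then have "measure lebesgue (W n) < \<delta>"
          using Wl \<delta>(1) by (simp add: emeasure_eq_measure2 ennreal_less_iff)
        then show "emeasure \<nu> (W n) \<le> 1"
          using nn_integral_deriv_elementary[OF loc \<delta>(2) p] \<nu>[OF fmeasurableD[OF Wl]] by simp
        show "W n \<in> sets \<nu>" using Wl by (simp add: fmeasurableD)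
      qed
      have "(SUP n. emeasure \<nu> (W n)) = emeasure \<nu> (\<Union>n. W n)"
        using bound(1) by (intro SUP_emeasure_incseq) (force simp: incseq_def W_def)+
      then show ?thesis using bound(2) UW by (metis SUP_least)
    qed (use D(3) in auto)
  qed
  have "emeasure \<nu> K < \<infinity>" if K: "K \<in> sets lebesgue" "emeasure lebesgue K < \<infinity>" for K
  proof -
    define T where "T n = K - {- real n..real n}" for n :: nat
    have Tm: "T n \<in> sets lebesgue" for n using K(1) by (auto simp: T_def)
    have "(\<lambda>n. emeasure lebesgue (T n)) \<longlonglongrightarrow> emeasure lebesgue (\<Inter>n. T n)"
    proof (rule Lim_emeasure_decseq)
      show "range T \<subseteq> sets lebesgue" using Tm by auto
      show "decseq T" by (force simp: T_def decseq_def)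
      have "emeasure lebesgue (T n) \<le> emeasure lebesgue K" for n
        using K(1) by (intro emeasure_mono) (auto simp: T_def)
      then show "emeasure lebesgue (T n) \<noteq> \<infinity>" for n using K(2) by (metis less_irrefl order_le_less_trans)
    qed
    moreover have "(\<Inter>n. T n) = {}"
    proof -
      have "\<exists>n. x \<in> {- real n..real n}" for x :: real
        using real_arch_simple[of "\<bar>x\<bar>"] by (auto simp: abs_le_iff minus_le_iff)
      then show ?thesis by (auto simp: T_def)
    qed
    ultimately have "\<forall>\<^sub>F n in sequentially. emeasure lebesgue (T n) < ennreal (\<delta>/2)"
      using \<delta>(1) by (intro order_tendstoD(2)[where y=0]) auto
    then obtain n where n: "emeasure lebesgue (T n) < ennreal (\<delta>/2)" by (auto simp: eventually_sequentially)
    obtain U where U: "open U" "T n \<subseteq> U" "U - T n \<in> lmeasurable" "emeasure lebesgue (U - T n) < ennreal (\<delta>/2)"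
      using sets_lebesgue_outer_open[OF Tm[of n], of "\<delta>/2"] \<delta>(1) by auto
    have "emeasure lebesgue U = emeasure lebesgue (T n \<union> (U - T n))" using U(2) by (simp add: Un_absorb1)
    also have "\<dots> \<le> emeasure lebesgue (T n) + emeasure lebesgue (U - T n)"
      using Tm U(3) by (intro emeasure_subadditive) (auto dest: fmeasurableD)
    also have "\<dots> < ennreal (\<delta>/2) + ennreal (\<delta>/2)" using n U(4) by (rule add_strict_mono)
    also have "\<dots> = ennreal \<delta>" using \<delta>(1) by (simp flip: ennreal_plus)
    finally have \<nu>U: "emeasure \<nu> U \<le> 1" by (rule open_le[OF U(1)])
    obtain C where C: "finite C" "{- real n..real n} \<subseteq> (\<Union>c\<in>C. ball c (\<delta>/3))"
      using compactE_image[OF compact_Icc[of "- real n" "real n"], of "{- real n..real n}" "\<lambda>c. ball c (\<delta>/3)"] \<delta>(1)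
      by (metis (no_types, lifting) UN_I centre_in_ball divide_pos_pos open_ball subsetI zero_less_numeral)
    have ball: "emeasure \<nu> (ball c (\<delta>/3)) \<le> 1" for c
      using \<delta>(1) by (intro open_le) (auto simp: ball_eq_greaterThanLessThan intro!: ennreal_lessI)
    have "emeasure \<nu> (\<Union>c\<in>C. ball c (\<delta>/3)) \<le> (\<Sum>c\<in>C. emeasure \<nu> (ball c (\<delta>/3)))"
      using C(1) by (intro emeasure_subadditive_finite) auto
    also have "\<dots> \<le> (\<Sum>c\<in>C. 1)" by (intro sum_mono ball)
    also have "\<dots> < \<infinity>" by (simp add: of_nat_less_top)
    finally have fin: "emeasure \<nu> (\<Union>c\<in>C. ball c (\<delta>/3)) < \<infinity>" .
    have Um: "U \<in> sets \<nu>" "(\<Union>c\<in>C. ball c (\<delta>/3)) \<in> sets \<nu>"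
      using U(1) C(1) by auto
    have "K \<subseteq> U \<union> (\<Union>c\<in>C. ball c (\<delta>/3))" using U(2) C(2) unfolding T_def by blast
    then have "emeasure \<nu> K \<le> emeasure \<nu> (U \<union> (\<Union>c\<in>C. ball c (\<delta>/3)))"
      by (intro emeasure_mono sets.Un Um)
    also have "\<dots> \<le> emeasure \<nu> U + emeasure \<nu> (\<Union>c\<in>C. ball c (\<delta>/3))"
      by (intro emeasure_subadditive Um)
    also have "\<dots> < \<infinity>" using \<nu>U fin by (simp add: order_le_less_trans[OF _ ennreal_one_less_top])
    finally show ?thesis .
  qed
  then show ?thesis using gm \<nu> by (auto simp: L1_G_def)
qed

theorem theorem3p0p2:
  fixes f :: "real \<Rightarrow> real"
  shows "f \<in> AC_loc UNIV \<and> deriv f \<in> L1_G \<longleftrightarrow> f \<in> AC UNIV"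
  using AC_if_deriv_L1_G AC_UNIV_imp_AC_loc deriv_L1_G_if_AC by blast

end
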